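(* There is a set $S$ of rational primes, having a natural density (relative to the set of all primes) that lies in $(0,1)$, and a constant $C_S$, such that $$\mathsf M_S(N)=C_S+O(N^{-1})\qquad (N\to\infty).$$
   Context: $\mathbb P$ is the set of rational primes and $|\cdot|_p$ is the $p$-adic absolute value on $\mathbb Q$ with $|p|_p=p^{-1}$. The natural density of $S\subseteq\mathbb P$ is $\lim_{x\to\infty}|\{p\in S:p\le x\}|/|\{p\in\mathbb P:p\le x\}|$, if it exists. For $S\subseteq\mathbb P$ let $R_S=\{r\in\mathbb Q: |r|_p\le 1\text{ for all }p\in\mathbb P\setminus S\}$, and let $T_S$ be the continuous endomorphism of the compact dual group $\widehat{R_S}$ dual to $r\mapsto 2r$ on the discrete group $R_S$. A closed orbit $\tau$ of length $|\tau|=n$ is a set $\{x,T_S(x),\dots,T_S^n(x)=x\}$ of cardinality $n$. Define $\mathsf M_S(N)=\sum_{|\tau|\le N}e^{-h|\tau|}$, the sum over closed orbits of $T_S$ of length at most $N$, where $h=h(T_S)$ is the topological entropy. It is known that $h(T_S)=\log 2$ and that the number of points with $T_S^nx=x$ is $(2^n-1)\prod_{p\in S}|2^n-1|_p$, so that, with $|x|_S=\prod_{p\in S}|x|_p$ and $\mu$ the Möbius function, $$\mathsf M_S(N)=\sum_{n\le N}\frac1{n2^n}\sum_{d\mid n}\mu(n/d)\,(2^d-1)\,|2^d-1|_S .$$ *)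

theory Defs
  imports
    "HOL-Analysis.Analysis"
    "HOL-Library.Landau_Symbols"
    "HOL-Computational_Algebra.Primes"
begin

definition has_prime_density :: "nat set \<Rightarrow> real \<Rightarrow> bool" where
  "has_prime_density S d \<longleftrightarrow>
     ((\<lambda>x::real. real (card {p \<in> S. prime p \<and> real p \<le> x})
               / real (card {p::nat. prime p \<and> real p \<le> x})) \<longlongrightarrow> d) at_top"

text \<open>
  Here \<^term>\<open>quotient_of x\<close> is the pair (numerator, denominator) in lowest terms, so the exponent
  is minus the valuation of \<open>x\<close> at \<open>p\<close>, and \<open>padic_abs p p = 1 / p\<close> for prime \<open>p\<close>.
\<close>

definition padic_abs :: "nat \<Rightarrow> rat \<Rightarrow> real" where
  "padic_abs p x =
     (if x = 0 then 0
      else real p powi (int (multiplicity (int p) (snd (quotient_of x)))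
                        - int (multiplicity (int p) (fst (quotient_of x)))))"

definition R_ring :: "nat set \<Rightarrow> rat set" where
  "R_ring S = {r. \<forall>p. prime p \<and> p \<notin> S \<longrightarrow> padic_abs p r \<le> 1}"

text \<open>
  Pontryagin dual of a discrete additive group \<open>A\<close>: the homomorphisms from \<open>A\<close> to the unit circle,
  represented as functions that are \<^const>\<open>undefined\<close> outside \<open>A\<close>. The compact subsets of a discrete
  group are the finite ones, so the compact-open topology is that of pointwise convergence, i.e. the
  subspace topology of the product of circles.
\<close>

definition characters :: "'a::ab_group_add set \<Rightarrow> ('a \<Rightarrow> complex) set" where
  "characters A =
     {\<phi> \<in> A \<rightarrow>\<^sub>E sphere 0 1. \<forall>a\<in>A. \<forall>b\<in>A. \<phi> (a + b) = \<phi> a * \<phi> b}"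

definition dual_topology :: "'a::ab_group_add set \<Rightarrow> ('a \<Rightarrow> complex) topology" where
  "dual_topology A =
     subtopology (product_topology (\<lambda>_. top_of_set (sphere 0 1)) A) (characters A)"

definition dual_map ::
  "'a set \<Rightarrow> ('a \<Rightarrow> 'a) \<Rightarrow> ('a \<Rightarrow> complex) \<Rightarrow> ('a \<Rightarrow> complex)" where
  "dual_map A f \<phi> = (\<lambda>a\<in>A. \<phi> (f a))"

definition T_map :: "nat set \<Rightarrow> (rat \<Rightarrow> complex) \<Rightarrow> (rat \<Rightarrow> complex)" where
  "T_map S = dual_map (R_ring S) (\<lambda>r. 2 * r)"

text \<open>
  Topological entropy of a continuous self-map \<open>T\<close> of a compact space \<open>X\<close>, in the sense of Adler,
  Konheim and McAndrew. By subadditivity the \<^const>\<open>limsup\<close> below is a limit. The least number in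
  \<open>subcover_number\<close> is meaningful because \<open>X\<close> is compact.
\<close>

definition open_cover_of :: "'a topology \<Rightarrow> 'a set set \<Rightarrow> bool" where
  "open_cover_of X \<U> \<longleftrightarrow> (\<forall>U\<in>\<U>. openin X U) \<and> \<Union>\<U> = topspace X"

definition subcover_number :: "'a topology \<Rightarrow> 'a set set \<Rightarrow> nat" where
  "subcover_number X \<U> =
     (LEAST n. \<exists>\<V>. \<V> \<subseteq> \<U> \<and> finite \<V> \<and> card \<V> = n \<and> \<Union>\<V> = topspace X)"

definition iterated_cover ::
  "'a topology \<Rightarrow> ('a \<Rightarrow> 'a) \<Rightarrow> 'a set set \<Rightarrow> nat \<Rightarrow> 'a set set" where
  "iterated_cover X T \<U> n =
     {{x \<in> topspace X. \<forall>i<n. (T ^^ i) x \<in> U i} | U. \<forall>i<n. U i \<in> \<U>}"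

definition cover_entropy :: "'a topology \<Rightarrow> ('a \<Rightarrow> 'a) \<Rightarrow> 'a set set \<Rightarrow> ereal" where
  "cover_entropy X T \<U> =
     limsup (\<lambda>n. ereal (ln (real (subcover_number X (iterated_cover X T \<U> n))) / real n))"

definition topological_entropy :: "'a topology \<Rightarrow> ('a \<Rightarrow> 'a) \<Rightarrow> ereal" where
  "topological_entropy X T = (SUP \<U> \<in> {\<U>. open_cover_of X \<U>}. cover_entropy X T \<U>)"

text \<open>
  A closed orbit of length \<open>n\<close>; the cardinality condition forces \<open>n \<ge> 1\<close> and makes \<open>n\<close> the least
  period of its points.
\<close>

definition closed_orbit :: "'a set \<Rightarrow> ('a \<Rightarrow> 'a) \<Rightarrow> nat \<Rightarrow> 'a set \<Rightarrow> bool" where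
  "closed_orbit X T n \<tau> \<longleftrightarrow>
     (\<exists>x\<in>X. (T ^^ n) x = x \<and> \<tau> = (\<lambda>i. (T ^^ i) x) ` {0..n} \<and> card \<tau> = n)"

text \<open>
  There are only finitely many closed orbits of each length and the entropy is finite
  (it is \<open>ln 2\<close>), so neither the finite sum nor \<^const>\<open>real_of_ereal\<close> takes a default value.
\<close>

definition entropy_T :: "nat set \<Rightarrow> real" where
  "entropy_T S = real_of_ereal (topological_entropy (dual_topology (R_ring S)) (T_map S))"

definition M_sum :: "nat set \<Rightarrow> nat \<Rightarrow> real" where
  "M_sum S N =
     (\<Sum>\<tau> | \<exists>n\<le>N. closed_orbit (characters (R_ring S)) (T_map S) n \<tau>.
        exp (- entropy_T S * real (card \<tau>)))"

end

theory Submission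
  imports Defs "HOL-Number_Theory.Number_Theory" "HOL-Real_Asymp.Real_Asymp"
begin

text \<open>
  The number of points of period \<open>n\<close> is at most \<open>(2^n - 1) / a\<close>, where \<open>a\<close> is the part of \<open>2^n - 1\<close>
  composed of primes in \<open>S\<close>. If \<open>a \<ge> n\<close> for every \<open>n\<close>, then the closed orbits of length \<open>n\<close>
  contribute at most \<open>1 / n^2\<close> to the Mertens sum, which gives the error term \<open>O(1 / N)\<close>.
  For \<open>a \<ge> n\<close> it suffices that for each prime power \<open>q\<close> the set \<open>S\<close> contains a prime modulo which
  \<open>2\<close> has order exactly \<open>q\<close>: such a prime exceeds \<open>q\<close>, and it divides \<open>2^n - 1\<close> whenever \<open>q\<close> divides \<open>n\<close>.

  The proper powers \<open>q\<close> need only \<open>O(sqrt x log x)\<close> primes up to \<open>x\<close>, which Chebyshev's lower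
  bound for the number of primes makes negligible. If \<open>q\<close> is prime, every prime factor of \<open>2^q - 1\<close>
  will do, and either there are at least two of them or \<open>2^q - 1\<close> is itself a prime; the primes of
  the latter kind are again negligible. In the former case choose a pair of prime factors of \<open>2^q - 1\<close>.
  These pairs are disjoint, so they form a matching on the primes; pairing the
  primes number \<open>2 j\<close> and \<open>2 j + 1\<close> gives another matching. The union of two matchings is
  bipartite, so the primes have a 2-colouring that splits every pair of both matchings. A colour class
  then has density exactly \<open>1/2\<close>, and it meets all the pairs of prime factors.
\<close>

section \<open>The ring and its characters\<close>

definition supported_by :: "nat set \<Rightarrow> nat \<Rightarrow> bool" where
  "supported_by S v \<longleftrightarrow> v > 0 \<and> (\<forall>p. prime p \<longrightarrow> p dvd v \<longrightarrow> p \<in> S)"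

lemma supported_by_1 [simp]: "supported_by S 1" "supported_by S (Suc 0)"
  by (auto simp: supported_by_def)

lemma supported_by_mult: "supported_by S a \<Longrightarrow> supported_by S b \<Longrightarrow> supported_by S (a * b)"
  by (auto simp: supported_by_def prime_dvd_mult_iff)

lemma supported_by_pos: "supported_by S v \<Longrightarrow> v > 0"
  by (simp add: supported_by_def)

lemma supported_by_prod: "(\<And>i. i \<in> I \<Longrightarrow> supported_by S (f i)) \<Longrightarrow> supported_by S (prod f I)"
  by (induction I rule: infinite_finite_induct) (auto intro: supported_by_mult)

text \<open>Numerator and denominator are coprime. If \<open>p\<close> divides the denominator, only
  the positive part of the exponent survives; otherwise the exponent is at most 0.\<close>

lemma padic_abs_le_1_iff:
  assumes "prime p"
  shows "padic_abs p r \<le> 1 \<longleftrightarrow> \<not> int p dvd snd (quotient_of r)"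
proof -
  obtain u v where uv: "quotient_of r = (u, v)" by force
  have v: "v > 0" and cop: "coprime u v"
    using quotient_of_denom_pos[OF uv] quotient_of_coprime[OF uv] by auto
  have p: "prime (int p)" "real p > 1" using assms prime_gt_1_nat[OF assms] by auto
  show ?thesis
  proof (cases "int p dvd v")
    case True
    then have "\<not> int p dvd u"
      using cop p(1) not_coprimeI not_prime_unit by blast
    then have "multiplicity (int p) u = 0" by (rule not_dvd_imp_multiplicity_0)
    moreover have "multiplicity (int p) v > 0"
      using True v p(1) by (simp add: prime_multiplicity_gt_zero_iff)
    moreover have "r \<noteq> 0" using True uv p by auto
    ultimately show ?thesis using uv True p(2)
      by (simp add: padic_abs_def not_le power_int_of_nat one_less_power)
  next
    case False
    then have "multiplicity (int p) v = 0" by (rule not_dvd_imp_multiplicity_0)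
    then have "padic_abs p r \<le> 1"
      using uv p(2) by (simp add: padic_abs_def power_int_minus inverse_le_1_iff one_le_power)
    with False uv show ?thesis by simp
  qed
qed

text \<open>This identifies the ring as the localization of the integers at the primes in
  \<open>S\<close>. The fraction need not be in lowest terms, which makes the closure properties
  immediate. Conversely, the reduced denominator divides any other denominator and so inherits its
  support.\<close>

lemma R_ring_iff:
  "r \<in> R_ring S \<longleftrightarrow> (\<exists>u v. supported_by S v \<and> r = of_int u / of_nat v)"
proof
  assume r: "r \<in> R_ring S"
  obtain u v where uv: "quotient_of r = (u, v)" by force
  have v: "v > 0" using quotient_of_denom_pos[OF uv] .
  have "supported_by S (nat v)"
    unfolding supported_by_def
  proof (intro conjI allI impI)
    fix p assume p: "prime p" "p dvd nat v"
    then have "int p dvd v" using v by (metis int_dvd_int_iff int_nat_eq order_less_le)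
    then have "\<not> padic_abs p r \<le> 1" using padic_abs_le_1_iff[OF p(1)] uv by simp
    with r p(1) show "p \<in> S" by (auto simp: R_ring_def)
  qed (use v in auto)
  moreover have "r = of_int u / of_nat (nat v)"
    using quotient_of_div[OF uv] v by simp
  ultimately show "\<exists>u v. supported_by S v \<and> r = of_int u / of_nat v" by blast
next
  assume "\<exists>u v. supported_by S v \<and> r = of_int u / of_nat v"
  then obtain u v where v: "supported_by S v" and r: "r = of_int u / of_nat v" by blast
  obtain a b where ab: "quotient_of r = (a, b)" by force
  have b: "b > 0" and cop: "coprime a b"
    using quotient_of_denom_pos[OF ab] quotient_of_coprime[OF ab] by auto
  have "v > 0" using v by (rule supported_by_pos)
  have "rat_of_int a * rat_of_int (int v) = rat_of_int u * rat_of_int b"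
    using quotient_of_div[OF ab] r b \<open>v > 0\<close> by (simp add: field_simps)
  then have "rat_of_int (a * int v) = rat_of_int (u * b)" by simp
  then have "a * int v = u * b" by (simp only: of_int_eq_iff)
  then have "b dvd a * int v" by simp
  with cop have bv: "b dvd int v" by (simp add: coprime_commute coprime_dvd_mult_right_iff)
  show "r \<in> R_ring S"
    unfolding R_ring_def
  proof (clarify)
    fix p assume p: "prime p" "p \<notin> S"
    then have "\<not> int p dvd b"
      using v bv by (meson dvd_trans int_dvd_int_iff supported_by_def)
    with padic_abs_le_1_iff[OF p(1)] ab show "padic_abs p r \<le> 1" by simp
  qed
qed

lemma R_ring_of_int [simp]: "of_int k \<in> R_ring S"
  unfolding R_ring_iff by (rule exI[of _ k], rule exI[of _ 1]) auto

lemma R_ring_1 [simp]: "1 \<in> R_ring S" and R_ring_0 [simp]: "0 \<in> R_ring S"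
  using R_ring_of_int[of 1] R_ring_of_int[of 0] by auto

lemma R_ring_add: "r \<in> R_ring S \<Longrightarrow> s \<in> R_ring S \<Longrightarrow> r + s \<in> R_ring S"
proof -
  assume "r \<in> R_ring S" "s \<in> R_ring S"
  then obtain u v a b where *: "supported_by S v" "r = of_int u / of_nat v" "supported_by S b" "s = of_int a / of_nat b"
    unfolding R_ring_iff by blast
  then have "r + s = of_int (u * int b + a * int v) / of_nat (v * b)"
    using supported_by_pos[OF *(1)] supported_by_pos[OF *(3)] by (simp add: field_simps)
  with * show ?thesis unfolding R_ring_iff using supported_by_mult by blast
qed

lemma R_ring_mult: "r \<in> R_ring S \<Longrightarrow> s \<in> R_ring S \<Longrightarrow> r * s \<in> R_ring S"
proof -
  assume "r \<in> R_ring S" "s \<in> R_ring S"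
  then obtain u v a b where *: "supported_by S v" "r = of_int u / of_nat v" "supported_by S b" "s = of_int a / of_nat b"
    unfolding R_ring_iff by blast
  then have "r * s = of_int (u * a) / of_nat (v * b)" by simp
  with * show ?thesis unfolding R_ring_iff using supported_by_mult by blast
qed

lemma R_ring_inverse: "supported_by S v \<Longrightarrow> 1 / of_nat v \<in> R_ring S"
  unfolding R_ring_iff by (metis of_int_1)

lemma R_ring_of_nat [simp]: "of_nat k \<in> R_ring S"
  using R_ring_of_int[of "int k"] by simp

lemma R_ring_double: "r \<in> R_ring S \<Longrightarrow> 2 * r \<in> R_ring S"
  using R_ring_add[of r S r] by simp

lemma R_ring_pow2: "r \<in> R_ring S \<Longrightarrow> 2 ^ n * r \<in> R_ring S"
  using R_ring_mult[of "of_nat (2 ^ n)" S r] R_ring_of_nat[of "2 ^ n"] by simp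

section \<open>Characters of the ring and iterates of the dual map\<close>

lemma characters_norm: "\<phi> \<in> characters A \<Longrightarrow> a \<in> A \<Longrightarrow> norm (\<phi> a) = 1"
  by (auto simp: characters_def)

lemma characters_add: "\<phi> \<in> characters A \<Longrightarrow> a \<in> A \<Longrightarrow> b \<in> A \<Longrightarrow> \<phi> (a + b) = \<phi> a * \<phi> b"
  by (auto simp: characters_def)

lemma characters_eqI:
  assumes "\<phi> \<in> characters A" "\<psi> \<in> characters A" "\<And>a. a \<in> A \<Longrightarrow> \<phi> a = \<psi> a"
  shows "\<phi> = \<psi>"
  using assms by (intro PiE_ext[where k = A and s = "\<lambda>_. sphere 0 1"]) (auto simp: characters_def)

lemma characters_0:
  assumes "\<phi> \<in> characters A" "0 \<in> A"
  shows "\<phi> 0 = 1"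
proof -
  have "\<phi> 0 * \<phi> 0 = \<phi> 0" using characters_add[OF assms(1,2,2)] by simp
  moreover have "\<phi> 0 \<noteq> 0" using characters_norm[OF assms] by auto
  ultimately show ?thesis by simp
qed

lemma characters_of_nat_mult:
  assumes "\<phi> \<in> characters (R_ring S)" "r \<in> R_ring S"
  shows "\<phi> (of_nat k * r) = \<phi> r ^ k"
proof (induction k)
  case 0
  then show ?case using characters_0[OF assms(1)] by simp
next
  case (Suc k)
  have "\<phi> (of_nat k * r + r) = \<phi> (of_nat k * r) * \<phi> r"
    by (intro characters_add[OF assms(1)] R_ring_mult assms) auto
  with Suc show ?case by (simp add: algebra_simps)
qed

lemma characters_minus:
  assumes "\<phi> \<in> characters (R_ring S)" "r \<in> R_ring S"
  shows "\<phi> (- r) = inverse (\<phi> r)"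
proof -
  have m: "- r \<in> R_ring S" using R_ring_mult[OF R_ring_of_int[of "-1"] assms(2)] by simp
  have "\<phi> (- r) * \<phi> r = 1"
    using characters_add[OF assms(1) m assms(2)] characters_0[OF assms(1)] by simp
  then show ?thesis by (metis inverse_unique mult.commute)
qed

lemma funpow_T_map:
  assumes "\<phi> \<in> characters (R_ring S)"
  shows "(T_map S ^^ n) \<phi> = (\<lambda>r\<in>R_ring S. \<phi> (2 ^ n * r))"
proof (induction n)
  case 0
  then show ?case using assms by (auto simp: characters_def PiE_def extensional_restrict)
next
  case (Suc n)
  then show ?case
    using R_ring_double[of _ S]
    by (auto simp: T_map_def dual_map_def restrict_def fun_eq_iff mult.assoc mult.left_commute)
qed

lemma funpow_T_map_in_characters:
  assumes "\<phi> \<in> characters (R_ring S)"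
  shows "(T_map S ^^ n) \<phi> \<in> characters (R_ring S)"
proof -
  have "\<phi> (2 ^ n * (a + b)) = \<phi> (2 ^ n * a) * \<phi> (2 ^ n * b)"
    if "a \<in> R_ring S" "b \<in> R_ring S" for a b
    using characters_add[OF assms R_ring_pow2[OF that(1)] R_ring_pow2[OF that(2)]]
    by (simp add: ring_distribs)
  then show ?thesis
    using characters_norm[OF assms R_ring_pow2]
    by (auto simp: funpow_T_map[OF assms] characters_def R_ring_add)
qed

text \<open>The characters that extend to the real line. The dual map doubles \<open>t\<close>, so
  their orbits can be computed explicitly.\<close>

definition std_char :: "nat set \<Rightarrow> real \<Rightarrow> rat \<Rightarrow> complex" where
  "std_char S t = (\<lambda>r\<in>R_ring S. cis (2 * pi * t * of_rat r))"

lemma std_char_in [simp]: "std_char S t \<in> characters (R_ring S)"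
  by (auto simp: std_char_def characters_def R_ring_add cis_mult of_rat_add algebra_simps)

section \<open>Topological entropy\<close>

lemma topspace_dual_topology [simp]: "topspace (dual_topology A) = characters A"
  by (auto simp: dual_topology_def characters_def)

lemma continuous_map_eval_sphere:
  "a \<in> A \<Longrightarrow> continuous_map (product_topology (\<lambda>_. top_of_set (sphere (0::complex) 1)) A) euclidean (\<lambda>\<phi>. \<phi> a)"
  using continuous_map_product_projection[of a A "\<lambda>_. top_of_set (sphere (0::complex) 1)"]
  by (simp add: continuous_map_in_subtopology)

lemma continuous_map_complex_mult:
  fixes f g :: "'a \<Rightarrow> complex"
  assumes "continuous_map X euclidean f" "continuous_map X euclidean g"
  shows "continuous_map X euclidean (\<lambda>x. f x * g x)"
proof -
  have "continuous_map X euclidean (\<lambda>x. (f x, g x))"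
    using continuous_map_pairedI[OF assms] by simp
  moreover have "continuous_map euclidean euclidean (\<lambda>z. fst z * snd z :: complex)"
    by (intro iffD2[OF continuous_map_iff_continuous2] continuous_intros)
  ultimately show ?thesis
    using continuous_map_compose[of X euclidean "\<lambda>x. (f x, g x)" euclidean "\<lambda>z. fst z * snd z"]
    by (simp add: o_def)
qed

lemma continuous_map_eval: "a \<in> A \<Longrightarrow> continuous_map (dual_topology A) euclidean (\<lambda>\<phi>. \<phi> a)"
  unfolding dual_topology_def
  by (intro continuous_map_from_subtopology continuous_map_eval_sphere)

text \<open>By Tychonoff the product of circles is compact, and the characters are cut out of it by
  the closed conditions of multiplicativity, one for each pair in \<open>A\<close>.\<close>

lemma compact_space_dual_topology:
  assumes "\<And>a b. a \<in> A \<Longrightarrow> b \<in> A \<Longrightarrow> a + b \<in> A" "A \<noteq> {}"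
  shows "compact_space (dual_topology A)"
proof -
  let ?P = "product_topology (\<lambda>_. top_of_set (sphere (0::complex) 1)) A"
  have "closedin ?P {\<phi> \<in> topspace ?P. \<phi> (a + b) = \<phi> a * \<phi> b}" if "a \<in> A" "b \<in> A" for a b
    using that assms(1)
    by (intro closedin_continuous_maps_eq[where Y = euclidean] continuous_map_eval_sphere continuous_map_complex_mult) auto
  then have "closedin ?P (\<Inter>x\<in>A \<times> A. {\<phi> \<in> topspace ?P. \<phi> (fst x + snd x) = \<phi> (fst x) * \<phi> (snd x)})"
    using assms(2) by (intro closedin_Inter) auto
  also have "\<dots> = characters A"
    using assms(2) by (auto simp: characters_def)
  finally have cl: "closedin ?P (characters A)" .
  have "compact_space ?P"
    by (auto simp: compact_space_product_topology compact_space_subtopology)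
  then have "compactin ?P (characters A)"
    using cl by (rule closedin_compact_space)
  then show ?thesis unfolding dual_topology_def by (rule compact_space_subtopology)
qed

text \<open>A character takes multiples to powers, and the \<open>k\<close>-th power is Lipschitz
  with constant \<open>k\<close> on the unit circle. Negative \<open>k\<close> reduce to positive
  ones because inversion is an isometry of the circle.\<close>

lemma norm_character_diff_le:
  assumes "\<phi> \<in> characters (R_ring S)" "\<psi> \<in> characters (R_ring S)" "r \<in> R_ring S"
  shows "norm (\<psi> (of_int k * r) - \<phi> (of_int k * r)) \<le> \<bar>of_int k\<bar> * norm (\<psi> r - \<phi> r)"
proof -
  have nat: "norm (\<psi> (of_nat j * r) - \<phi> (of_nat j * r)) \<le> real j * norm (\<psi> r - \<phi> r)" for j
    using assms by (simp add: characters_of_nat_mult norm_power_diff characters_norm)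
  show ?thesis
  proof (cases "k \<ge> 0")
    case True
    then show ?thesis using nat[of "nat k"] by simp
  next
    case False
    define s where "s = of_nat (nat (- k)) * r"
    have s: "s \<in> R_ring S" unfolding s_def by (intro R_ring_mult assms) auto
    have "of_int k * r = - s" using False by (simp add: s_def)
    then have "norm (\<psi> (of_int k * r) - \<phi> (of_int k * r)) = norm (inverse (\<psi> s) - inverse (\<phi> s))"
      using assms s by (simp add: characters_minus)
    also have "\<psi> s \<noteq> 0" "\<phi> s \<noteq> 0"
      using characters_norm[OF assms(1) s] characters_norm[OF assms(2) s] by auto
    then have "norm (inverse (\<psi> s) - inverse (\<phi> s)) = norm (\<psi> s - \<phi> s)"
      using characters_norm[OF assms(1) s] characters_norm[OF assms(2) s]
      by (simp add: inverse_diff_inverse norm_mult norm_inverse)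
    also have "\<dots> \<le> \<bar>of_int k\<bar> * norm (\<psi> r - \<phi> r)"
      using nat[of "nat (- k)"] False by (simp add: s_def)
    finally show ?thesis .
  qed
qed

text \<open>A basic open set constrains only finitely many coordinates. The rationals that index
  them have a common denominator \<open>m\<close>, so they are integer multiples of
  \<open>1 / m\<close>, and closeness at this single argument controls all of them.\<close>

lemma dual_topology_nbhd:
  assumes U: "openin (dual_topology (R_ring S)) U" and \<phi>: "\<phi> \<in> U"
  obtains m :: nat and \<delta> :: real where "supported_by S m" "\<delta> > 0"
    "\<And>\<psi>. \<psi> \<in> characters (R_ring S) \<Longrightarrow> norm (\<psi> (1 / of_nat m) - \<phi> (1 / of_nat m)) < \<delta> \<Longrightarrow> \<psi> \<in> U"
proof -
  let ?R = "R_ring S"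
  let ?P = "product_topology (\<lambda>_. top_of_set (sphere (0::complex) 1)) ?R"
  have \<phi>X: "\<phi> \<in> characters ?R" using openin_subset[OF U] \<phi> by auto
  obtain U' where U': "openin ?P U'" "U = U' \<inter> characters ?R"
    using U unfolding dual_topology_def openin_subtopology by blast
  with \<phi> obtain W where W: "finite {i \<in> ?R. W i \<noteq> sphere 0 1}"
     "\<And>i. i \<in> ?R \<Longrightarrow> openin (top_of_set (sphere 0 1)) (W i)" "\<phi> \<in> Pi\<^sub>E ?R W" "Pi\<^sub>E ?R W \<subseteq> U'"
    by (auto simp: openin_product_topology_alt)
  define F where "F = {i \<in> ?R. W i \<noteq> sphere 0 1}"
  have F: "finite F" "F \<subseteq> ?R" using W(1) by (auto simp: F_def)
  have "\<exists>e>0. \<forall>z\<in>sphere 0 1. dist z (\<phi> i) < e \<longrightarrow> z \<in> W i" if "i \<in> F" for i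
    using that W(2)[of i] W(3) F(2) unfolding openin_euclidean_subtopology_iff by blast
  then obtain e where e: "\<And>i. i \<in> F \<Longrightarrow> e i > 0"
    "\<And>i z. i \<in> F \<Longrightarrow> z \<in> sphere 0 1 \<Longrightarrow> dist z (\<phi> i) < e i \<Longrightarrow> z \<in> W i" by metis
  have "\<forall>i\<in>F. \<exists>u v. supported_by S v \<and> i = of_int u / of_nat v"
    using F(2) R_ring_iff by blast
  then obtain u v where uv: "\<And>i. i \<in> F \<Longrightarrow> supported_by S (v i)" "\<And>i. i \<in> F \<Longrightarrow> i = of_int (u i) / of_nat (v i)"
    by metis
  define m where "m = prod v F"
  define k where "k i = u i * int (prod v (F - {i}))" for i
  have m: "supported_by S m" unfolding m_def using uv(1) by (rule supported_by_prod)
  have k: "i = of_int (k i) * (1 / of_nat m)" if "i \<in> F" for i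
  proof -
    have "m = v i * prod v (F - {i})" unfolding m_def using F(1) that by (simp add: prod.remove)
    moreover have "m > 0" using m by (rule supported_by_pos)
    ultimately have "rat_of_nat (prod v (F - {i})) / rat_of_nat m = 1 / rat_of_nat (v i)"
      by (simp del: of_nat_prod add: field_simps)
    then show ?thesis using uv(2)[OF that]
      by (simp del: of_nat_prod add: k_def) (metis times_divide_eq_right mult.right_neutral)
  qed
  \<comment> \<open>The inserted 1 keeps \<open>Min\<close> meaningful when \<open>F\<close> is
    empty, and adding 1 to \<open>\<bar>k i\<bar>\<close> avoids a zero denominator and gives a
    strict inequality later.\<close>
  define \<delta> where "\<delta> = Min (insert 1 ((\<lambda>i. e i / (\<bar>of_int (k i)\<bar> + 1)) ` F))"
  have "\<delta> > 0" unfolding \<delta>_def using F(1) e(1) by (auto simp: Min_gr_iff add_nonneg_pos)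
  have \<delta>: "\<delta> * (\<bar>of_int (k i)\<bar> + 1) \<le> e i" if "i \<in> F" for i
  proof -
    have "\<delta> \<le> e i / (\<bar>of_int (k i)\<bar> + 1)" unfolding \<delta>_def using F(1) that by (intro Min_le) auto
    then show ?thesis by (simp add: field_simps)
  qed
  have "\<psi> \<in> U" if \<psi>: "\<psi> \<in> characters ?R" and d: "norm (\<psi> (1 / of_nat m) - \<phi> (1 / of_nat m)) < \<delta>" for \<psi>
  proof -
    have "\<psi> i \<in> W i" if i: "i \<in> ?R" for i
    proof (cases "i \<in> F")
      case True
      have "norm (\<psi> i - \<phi> i) \<le> \<bar>of_int (k i)\<bar> * norm (\<psi> (1 / of_nat m) - \<phi> (1 / of_nat m))"
        using norm_character_diff_le[OF \<phi>X \<psi> R_ring_inverse[OF m], of "k i"] k[OF True] by simp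
      also have "\<dots> \<le> \<bar>of_int (k i)\<bar> * \<delta>" using d by (intro mult_left_mono) auto
      also have "\<dots> < \<delta> * (\<bar>of_int (k i)\<bar> + 1)" using \<open>\<delta> > 0\<close> by (simp add: algebra_simps)
      also have "\<dots> \<le> e i" by (rule \<delta>[OF True])
      finally show ?thesis using characters_norm[OF \<psi> i] by (intro e(2)[OF True]) (auto simp: dist_norm)
    next
      case False
      then show ?thesis using i characters_norm[OF \<psi> i] by (auto simp: F_def)
    qed
    then have "\<psi> \<in> Pi\<^sub>E ?R W" using \<psi> by (auto simp: characters_def PiE_def)
    with W(4) U'(2) \<psi> show ?thesis by blast
  qed
  with m \<open>\<delta> > 0\<close> that show ?thesis by blast
qed

text \<open>The analogue of a Lebesgue number: compactness leaves finitely many of the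
  neighbourhoods from \<open>dual_topology_nbhd\<close>, and the product of their denominators
  serves for all of them.\<close>

lemma open_cover_uniform_nbhd:
  assumes "open_cover_of (dual_topology (R_ring S)) \<U>"
  obtains m :: nat and \<delta> :: real where "supported_by S m" "\<delta> > 0"
    "\<And>\<phi>. \<phi> \<in> characters (R_ring S) \<Longrightarrow> \<exists>U\<in>\<U>. \<forall>\<psi>\<in>characters (R_ring S).
        norm (\<psi> (1 / of_nat m) - \<phi> (1 / of_nat m)) < \<delta> \<longrightarrow> \<psi> \<in> U"
proof -
  let ?R = "R_ring S" and ?X = "characters (R_ring S)"
  have "\<forall>\<phi>\<in>?X. \<exists>U m \<delta>. U \<in> \<U> \<and> supported_by S m \<and> \<delta> > 0 \<and>
      (\<forall>\<psi>\<in>?X. norm (\<psi> (1 / of_nat m) - \<phi> (1 / of_nat m)) < \<delta> \<longrightarrow> \<psi> \<in> U)"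
  proof
    fix \<phi> assume "\<phi> \<in> ?X"
    then obtain U where U: "U \<in> \<U>" "\<phi> \<in> U" "openin (dual_topology ?R) U"
      using assms by (auto simp: open_cover_of_def)
    from dual_topology_nbhd[OF U(3,2)] U(1)
    show "\<exists>U m \<delta>. U \<in> \<U> \<and> supported_by S m \<and> \<delta> > 0 \<and>
      (\<forall>\<psi>\<in>?X. norm (\<psi> (1 / of_nat m) - \<phi> (1 / of_nat m)) < \<delta> \<longrightarrow> \<psi> \<in> U)" by metis
  qed
  then obtain U m \<delta> where *: "\<And>\<phi>. \<phi> \<in> ?X \<Longrightarrow> U \<phi> \<in> \<U>" "\<And>\<phi>. \<phi> \<in> ?X \<Longrightarrow> supported_by S (m \<phi>)"
    "\<And>\<phi>. \<phi> \<in> ?X \<Longrightarrow> \<delta> \<phi> > (0::real)"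
    "\<And>\<phi> \<psi>. \<phi> \<in> ?X \<Longrightarrow> \<psi> \<in> ?X \<Longrightarrow> norm (\<psi> (1 / of_nat (m \<phi>)) - \<phi> (1 / of_nat (m \<phi>))) < \<delta> \<phi> \<Longrightarrow> \<psi> \<in> U \<phi>"
    by metis
  \<comment> \<open>The radius is halved so that the other half is left for moving from \<phi> to
    \<psi> in the triangle inequality.\<close>
  define B where "B \<phi> = {\<psi> \<in> ?X. \<psi> (1 / of_nat (m \<phi>)) \<in> ball (\<phi> (1 / of_nat (m \<phi>))) (\<delta> \<phi> / 2)}" for \<phi>
  have "openin (dual_topology ?R) (B \<phi>)" if "\<phi> \<in> ?X" for \<phi>
    using openin_continuous_map_preimage[OF continuous_map_eval[OF R_ring_inverse[OF *(2)[OF that]]],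
        of "ball (\<phi> (1 / of_nat (m \<phi>))) (\<delta> \<phi> / 2)"]
    by (simp add: B_def)
  moreover have "compactin (dual_topology ?R) ?X"
    using compact_space_dual_topology[of ?R] R_ring_add[of _ S] R_ring_0[of S]
    unfolding compact_space_def topspace_dual_topology by (metis empty_iff)
  moreover have "?X \<subseteq> \<Union>(B ` ?X)" using *(3) by (auto simp: B_def)
  ultimately obtain \<F> where \<F>: "finite \<F>" "\<F> \<subseteq> B ` ?X" "?X \<subseteq> \<Union>\<F>"
    using compactinD[of "dual_topology ?R" ?X "B ` ?X"] by blast
  then obtain \<Phi> where \<Phi>: "finite \<Phi>" "\<Phi> \<subseteq> ?X" "\<F> = B ` \<Phi>"
    by (meson finite_subset_image)
  define M where "M = prod m \<Phi>"
  define k where "k \<phi> = prod m (\<Phi> - {\<phi>})" for \<phi>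
  have M: "supported_by S M" unfolding M_def using *(2) \<Phi>(2) by (intro supported_by_prod) auto
  have k: "1 / of_nat (m \<phi>) = of_int (int (k \<phi>)) * (1 / of_nat M :: rat)" if "\<phi> \<in> \<Phi>" for \<phi>
  proof -
    have "M = m \<phi> * k \<phi>" unfolding M_def k_def using \<Phi>(1) that by (simp add: prod.remove)
    moreover have "M > 0" using M by (rule supported_by_pos)
    ultimately show ?thesis by (simp add: field_simps)
  qed
  define d where "d = Min (insert 1 ((\<lambda>\<phi>. \<delta> \<phi> / (2 * (real (k \<phi>) + 1))) ` \<Phi>))"
  have "d > 0" unfolding d_def using \<Phi>(1,2) *(3) by (auto simp: Min_gr_iff add_nonneg_pos)
  have d: "d * (real (k \<phi>) + 1) \<le> \<delta> \<phi> / 2" if "\<phi> \<in> \<Phi>" for \<phi>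
  proof -
    have "d \<le> \<delta> \<phi> / (2 * (real (k \<phi>) + 1))" unfolding d_def using \<Phi>(1) that by (intro Min_le) auto
    then show ?thesis by (simp add: field_simps)
  qed
  have "\<exists>U\<in>\<U>. \<forall>\<psi>\<in>?X. norm (\<psi> (1 / of_nat M) - \<phi> (1 / of_nat M)) < d \<longrightarrow> \<psi> \<in> U" if \<phi>: "\<phi> \<in> ?X" for \<phi>
  proof -
    obtain \<phi>' where \<phi>': "\<phi>' \<in> \<Phi>" "\<phi> \<in> B \<phi>'" using \<phi> \<F>(3) \<Phi>(3) by auto
    have X': "\<phi>' \<in> ?X" using \<phi>'(1) \<Phi>(2) by auto
    have "\<psi> \<in> U \<phi>'" if \<psi>: "\<psi> \<in> ?X" and n: "norm (\<psi> (1 / of_nat M) - \<phi> (1 / of_nat M)) < d" for \<psi>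
    proof (rule *(4)[OF X' \<psi>])
      let ?r = "1 / of_nat (m \<phi>') :: rat"
      have "norm (\<psi> ?r - \<phi> ?r) \<le> real (k \<phi>') * norm (\<psi> (1 / of_nat M) - \<phi> (1 / of_nat M))"
        using norm_character_diff_le[OF \<phi> \<psi> R_ring_inverse[OF M], of "int (k \<phi>')"] k[OF \<phi>'(1)] by simp
      also have "\<dots> \<le> real (k \<phi>') * d" using n by (intro mult_left_mono) auto
      also have "\<dots> < d * (real (k \<phi>') + 1)" using \<open>d > 0\<close> by (simp add: algebra_simps)
      also have "\<dots> \<le> \<delta> \<phi>' / 2" by (rule d[OF \<phi>'(1)])
      finally have "norm (\<psi> ?r - \<phi> ?r) < \<delta> \<phi>' / 2" .
      moreover have "norm (\<phi> ?r - \<phi>' ?r) < \<delta> \<phi>' / 2"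
        using \<phi>'(2) by (simp add: B_def dist_norm norm_minus_commute)
      ultimately show "norm (\<psi> ?r - \<phi>' ?r) < \<delta> \<phi>'"
        using norm_diff_triangle_less[of "\<psi> ?r" "\<phi> ?r" "\<delta> \<phi>' / 2" "\<phi>' ?r" "\<delta> \<phi>' / 2"] by simp
    qed
    with *(1)[OF X'] show ?thesis by blast
  qed
  with M \<open>d > 0\<close> that show ?thesis by blast
qed

section \<open>The entropy is at most \<open>ln 2\<close>\<close>

lemma norm_cis_diff_le: "norm (cis a - cis b) \<le> \<bar>a - b\<bar>"
proof -
  have "cis a - cis b = cis b * (cis (a - b) - 1)" by (simp add: right_diff_distrib cis_mult)
  then have "norm (cis a - cis b) = norm (exp (\<i> * of_real (a - b)) - 1)" by (simp add: norm_mult cis_conv_exp)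
  also have "\<dots> = 2 * \<bar>sin ((a - b) / 2)\<bar>" by (rule dist_exp_i_1)
  also have "\<dots> \<le> 2 * \<bar>(a - b) / 2\<bar>" by (intro mult_left_mono abs_sin_x_le_abs_x) auto
  finally show ?thesis by simp
qed

lemma unit_circle_cis:
  assumes "norm z = 1"
  obtains t where "0 \<le> t" "t < 1" "z = cis (2 * pi * t)"
proof -
  have "z = cis (Arg2pi z)"
    by (rule trans[OF Arg2pi_eq]) (simp add: assms cis_conv_exp)
  moreover have "0 \<le> Arg2pi z / (2 * pi)" "Arg2pi z / (2 * pi) < 1"
    using Arg2pi_ge_0[of z] Arg2pi_lt_2pi[of z] by auto
  ultimately show ?thesis using that[of "Arg2pi z / (2 * pi)"] by simp
qed

text \<open>Each application of the map at most doubles the distance of two characters at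
  \<open>1 / m\<close>. Characters whose values there differ by less than \<delta> / 2^n therefore
  stay \<delta>-close for the first \<open>n\<close> times, and about 2^n / \<delta> equally spaced
  centres suffice.\<close>

lemma iterated_cover_small_subcover:
  assumes "open_cover_of (dual_topology (R_ring S)) \<U>"
  obtains L :: nat where "L > 0"
    "\<And>n. \<exists>\<V>. \<V> \<subseteq> iterated_cover (dual_topology (R_ring S)) (T_map S) \<U> n \<and> finite \<V> \<and> card \<V> \<le> L * 2 ^ n
         \<and> \<Union>\<V> = characters (R_ring S)"
proof -
  let ?R = "R_ring S" and ?X = "characters (R_ring S)"
  obtain m :: nat and \<delta> :: real where m: "supported_by S m" and "\<delta> > 0" and
    *: "\<And>\<phi>. \<phi> \<in> ?X \<Longrightarrow> \<exists>U\<in>\<U>. \<forall>\<psi>\<in>?X. norm (\<psi> (1 / of_nat m) - \<phi> (1 / of_nat m)) < \<delta> \<longrightarrow> \<psi> \<in> U"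
    using open_cover_uniform_nbhd[OF assms] by blast
  have "m > 0" using m by (rule supported_by_pos)
  obtain f where f: "\<And>\<phi>. \<phi> \<in> ?X \<Longrightarrow> f \<phi> \<in> \<U>"
    "\<And>\<phi> \<psi>. \<phi> \<in> ?X \<Longrightarrow> \<psi> \<in> ?X \<Longrightarrow> norm (\<psi> (1 / of_nat m) - \<phi> (1 / of_nat m)) < \<delta> \<Longrightarrow> \<psi> \<in> f \<phi>"
    using * by metis
  obtain L where L: "real L > 2 * pi / \<delta>" using reals_Archimedean2 by blast
  have "2 * pi / \<delta> > 0" using \<open>\<delta> > 0\<close> by simp
  then have "L > 0" using L by (metis less_trans of_nat_0_less_iff)
  have "\<exists>\<V>. \<V> \<subseteq> iterated_cover (dual_topology ?R) (T_map S) \<U> n \<and> finite \<V> \<and> card \<V> \<le> L * 2 ^ n \<and> \<Union>\<V> = ?X" for n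
  proof -
    define N where "N = L * 2 ^ n"
    have "N > 0" using \<open>L > 0\<close> by (simp add: N_def)
    \<comment> \<open>The factor \<open>m\<close> in the parameter makes the value of
      \<open>c j\<close> at \<open>1 / m\<close> the \<open>N\<close>-th root of unity with index
      \<open>j\<close>.\<close>
    define c where "c j = std_char S (real m * real j / real N)" for j :: nat
    define V where "V j = {x \<in> ?X. \<forall>i<n. (T_map S ^^ i) x \<in> f ((T_map S ^^ i) (c j))}" for j
    have c_in: "c j \<in> ?X" for j by (simp add: c_def)
    have "V ` {..<N} \<subseteq> iterated_cover (dual_topology ?R) (T_map S) \<U> n"
    proof
      fix A assume "A \<in> V ` {..<N}"
      then obtain j where "A = V j" by blast
      moreover have "\<forall>i<n. f ((T_map S ^^ i) (c j)) \<in> \<U>"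
        by (intro allI impI f(1) funpow_T_map_in_characters c_in)
      ultimately show "A \<in> iterated_cover (dual_topology ?R) (T_map S) \<U> n"
        unfolding iterated_cover_def topspace_dual_topology
        by (intro CollectI exI[of _ "\<lambda>i. f ((T_map S ^^ i) (c j))"] conjI) (simp_all only: V_def)
    qed
    moreover have "?X \<subseteq> \<Union>(V ` {..<N})"
    proof
      fix \<psi> assume \<psi>: "\<psi> \<in> ?X"
      obtain t where t: "0 \<le> t" "t < 1" "\<psi> (1 / of_nat m) = cis (2 * pi * t)"
        using unit_circle_cis[OF characters_norm[OF \<psi> R_ring_inverse[OF m]]] by blast
      \<comment> \<open>Index of the arc between consecutive \<open>N\<close>-th roots of unity that
        contains the value of \<psi>.\<close>
      define j where "j = nat \<lfloor>real N * t\<rfloor>"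
      have j: "real j \<le> real N * t" "real N * t < real j + 1"
        using t \<open>N > 0\<close> by (auto simp: j_def of_nat_floor)
      have "real N * t < real N * 1" using t \<open>N > 0\<close> by (intro mult_strict_left_mono) auto
      then have "j < N" using j(1) by linarith
      have d0: "norm (\<psi> (1 / of_nat m) - c j (1 / of_nat m)) \<le> 2 * pi / real N"
      proof -
        have "c j (1 / of_nat m) = cis (2 * pi * (real j / real N))"
          using \<open>m > 0\<close> R_ring_inverse[OF m] by (simp add: c_def std_char_def of_rat_divide mult.assoc)
        then have "norm (\<psi> (1 / of_nat m) - c j (1 / of_nat m)) \<le> \<bar>2 * pi * t - 2 * pi * (real j / real N)\<bar>"
          unfolding t(3) by (metis norm_cis_diff_le)
        also have "\<dots> = 2 * pi * ((real N * t - real j) / real N)"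
          using j(1) \<open>N > 0\<close> by (simp add: field_simps)
        also have "\<dots> \<le> 2 * pi * (1 / real N)"
          using j(2) by (intro mult_left_mono divide_right_mono) auto
        finally show ?thesis by simp
      qed
      have "(T_map S ^^ i) \<psi> \<in> f ((T_map S ^^ i) (c j))" if "i < n" for i
      proof (intro f(2) funpow_T_map_in_characters c_in \<psi>)
        have "norm ((T_map S ^^ i) \<psi> (1 / of_nat m) - (T_map S ^^ i) (c j) (1 / of_nat m)) =
              norm (\<psi> (of_int (2 ^ i) * (1 / of_nat m)) - c j (of_int (2 ^ i) * (1 / of_nat m)))"
          using R_ring_inverse[OF m] by (simp add: funpow_T_map \<psi> c_in)
        also have "\<dots> \<le> \<bar>of_int (2 ^ i)\<bar> * norm (\<psi> (1 / of_nat m) - c j (1 / of_nat m))"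
          by (rule norm_character_diff_le[OF c_in \<psi> R_ring_inverse[OF m]])
        also have "\<dots> \<le> 2 ^ i * (2 * pi / real N)" using d0 by (intro mult_mono) auto
        also have "\<dots> \<le> 2 ^ n * (2 * pi / real N)" using that by (intro mult_right_mono power_increasing) auto
        also have "\<dots> = 2 * pi / L" by (simp add: N_def)
        also have "\<dots> < \<delta>" using L \<open>\<delta> > 0\<close> \<open>L > 0\<close> by (simp add: field_simps)
        finally show "norm ((T_map S ^^ i) \<psi> (1 / of_nat m) - (T_map S ^^ i) (c j) (1 / of_nat m)) < \<delta>" .
      qed
      with \<psi> \<open>j < N\<close> show "\<psi> \<in> \<Union>(V ` {..<N})" by (auto simp: V_def)
    qed
    moreover have "\<Union>(V ` {..<N}) \<subseteq> ?X" by (auto simp: V_def)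
    moreover have "card (V ` {..<N}) \<le> N" using card_image_le[of "{..<N}" V] by simp
    ultimately show ?thesis unfolding N_def by (intro exI[of _ "V ` {..<L * 2 ^ n}"]) auto
  qed
  with \<open>L > 0\<close> that show ?thesis by blast
qed

lemma cover_entropy_le:
  assumes "open_cover_of (dual_topology (R_ring S)) \<U>"
  shows "cover_entropy (dual_topology (R_ring S)) (T_map S) \<U> \<le> ereal (ln 2)"
proof -
  let ?s = "\<lambda>n. subcover_number (dual_topology (R_ring S)) (iterated_cover (dual_topology (R_ring S)) (T_map S) \<U> n)"
  obtain L :: nat where L: "L > 0"
    "\<And>n. \<exists>\<V>. \<V> \<subseteq> iterated_cover (dual_topology (R_ring S)) (T_map S) \<U> n \<and> finite \<V> \<and> card \<V> \<le> L * 2 ^ n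
         \<and> \<Union>\<V> = characters (R_ring S)"
    using iterated_cover_small_subcover[OF assms] by metis
  have s: "?s n \<le> L * 2 ^ n" for n
  proof -
    obtain \<V> where \<V>: "\<V> \<subseteq> iterated_cover (dual_topology (R_ring S)) (T_map S) \<U> n" "finite \<V>"
      "card \<V> \<le> L * 2 ^ n" "\<Union>\<V> = characters (R_ring S)" using L(2)[of n] by blast
    then have "?s n \<le> card \<V>" unfolding subcover_number_def by (intro Least_le exI[of _ \<V>]) auto
    with \<V>(3) show ?thesis by simp
  qed
  have "ln (real (?s n)) \<le> ln (real L) + real n * ln 2" for n
  proof (cases "?s n = 0")
    \<comment> \<open>Here the left-hand side is \<open>ln 0\<close>, which is 0 by convention, and
      the right-hand side is nonnegative since \<open>L \<ge> 1\<close>.\<close>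
    case True
    then show ?thesis using L(1) by simp
  next
    case False
    have "real (?s n) \<le> real (L * 2 ^ n)" using s[of n] by (simp only: of_nat_le_iff)
    then have "ln (real (?s n)) \<le> ln (real L * 2 ^ n)"
      using False L(1) by (subst ln_le_cancel_iff) auto
    also have "\<dots> = ln (real L) + real n * ln 2" using L(1) by (simp add: ln_mult ln_realpow)
    finally show ?thesis .
  qed
  then have "cover_entropy (dual_topology (R_ring S)) (T_map S) \<U> \<le>
      limsup (\<lambda>n. ereal ((ln (real L) + real n * ln 2) / real n))"
    unfolding cover_entropy_def by (intro Limsup_mono always_eventually allI) (simp add: divide_right_mono)
  also have "(\<lambda>n. (ln (real L) + real n * ln 2) / real n) \<longlonglongrightarrow> ln 2" by real_asymp
  then have "(\<lambda>n. ereal ((ln (real L) + real n * ln 2) / real n)) \<longlonglongrightarrow> ereal (ln 2)" by simp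
  then have "limsup (\<lambda>n. ereal ((ln (real L) + real n * ln 2) / real n)) = ereal (ln 2)"
    by (intro lim_imp_Limsup) auto
  finally show ?thesis .
qed

section \<open>The entropy is at least \<open>ln 2\<close>\<close>

text \<open>Let 2^a be the exact power of 2 in \<open>k - j\<close>. Then \<open>a < n\<close>, and
  multiplying by 2^(n - 1 - a) turns the difference into an odd multiple of 2^(n - 1), half of the
  modulus.\<close>

lemma ex_antipodal_multiple:
  assumes "j < k" "k < 2 ^ n"
  obtains i q where "i < n" "odd q" "2 * 2 ^ i * (k - j) = q * (2 ^ n :: nat)"
proof -
  define a where "a = multiplicity 2 (k - j)"
  obtain q where q: "k - j = 2 ^ a * q" "odd q"
    using multiplicity_decompose'[of "k - j" "2 :: nat"] assms(1) unfolding a_def by auto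
  have "2 ^ a \<le> k - j" using q(1) odd_pos[OF q(2)] by simp
  then have "(2::nat) ^ a < 2 ^ n" using assms(2) by linarith
  then have "a < n" using power_less_imp_less_exp by (metis one_less_numeral_iff semiring_norm(76))
  then have "2 * 2 ^ (n - 1 - a) * 2 ^ a = (2 :: nat) ^ n"
    by (simp flip: power_add power_Suc)
  then have "2 * 2 ^ (n - 1 - a) * (k - j) = q * 2 ^ n" using q(1) by (metis mult.assoc mult.commute)
  with that[of "n - 1 - a" q] \<open>a < n\<close> q(2) show ?thesis by simp
qed

text \<open>After \<open>i\<close> doublings the two angles differ by an odd multiple of
  \<open>pi\<close>, so the values at 1 are opposite.\<close>

lemma std_char_antipodal:
  assumes "j < k" "k < 2 ^ n"
  obtains i where "i < n"
    "(T_map S ^^ i) (std_char S (real k / 2 ^ n)) 1 = - (T_map S ^^ i) (std_char S (real j / 2 ^ n)) 1"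
proof -
  obtain i q where iq: "i < n" "odd q" "2 * 2 ^ i * (k - j) = q * (2 ^ n :: nat)"
    using ex_antipodal_multiple[OF assms] by blast
  have "real (2 * 2 ^ i * (k - j)) = real (q * 2 ^ n)" using iq(3) by presburger
  then have "2 * 2 ^ i * (real k - real j) = real q * 2 ^ n"
    using assms(1) by (simp add: of_nat_diff)
  then have "2 * pi * (real k / 2 ^ n) * 2 ^ i = 2 * pi * (real j / 2 ^ n) * 2 ^ i + real q * pi"
    by (simp add: field_simps)
  then have "cis (2 * pi * (real k / 2 ^ n) * 2 ^ i) = cis (2 * pi * (real j / 2 ^ n) * 2 ^ i) * cis pi ^ q"
    by (simp only: cis_mult [symmetric] Complex.DeMoivre)
  also have "cis pi ^ q = -1" using iq(2) by simp
  finally show ?thesis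
    using that[OF iq(1)] R_ring_pow2[OF R_ring_1, of i S]
    by (simp add: funpow_T_map) (simp add: std_char_def of_rat_power)
qed

text \<open>Opposite points never lie in the same open half plane. Hence no member of the iterated
  cover contains two of the 2^n characters \<open>c k\<close> with \<open>k < 2 ^ n\<close>, which
  become antipodal at some time below \<open>n\<close>.\<close>

lemma subcover_number_half_planes:
  fixes S defines "X \<equiv> dual_topology (R_ring S)"
  defines "\<U> \<equiv> (\<lambda>w. {\<phi> \<in> characters (R_ring S). Re (\<phi> 1 * w) > 0}) ` {1, -1, \<i>, -\<i>}"
  shows "open_cover_of X \<U>"
    and "2 ^ n \<le> subcover_number X (iterated_cover X (T_map S) \<U> n)"
proof -
  let ?X = "characters (R_ring S)"
  have op: "openin X {\<phi> \<in> ?X. Re (\<phi> 1 * w) > 0}" for w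
  proof -
    have "open {z. Re (z * w) > 0}" by (intro open_Collect_less continuous_intros)
    then show ?thesis
      using openin_continuous_map_preimage[OF continuous_map_eval[OF R_ring_1[of S]], of "{z. Re (z * w) > 0}"]
      unfolding X_def by simp
  qed
  have "\<exists>w\<in>{1, -1, \<i>, -\<i>}. Re (\<phi> 1 * w) > 0" if "\<phi> \<in> ?X" for \<phi>
  proof -
    have "\<phi> 1 \<noteq> 0" using characters_norm[OF that R_ring_1] by auto
    then have "Re (\<phi> 1) \<noteq> 0 \<or> Im (\<phi> 1) \<noteq> 0" by (simp add: complex_eq_iff)
    then show ?thesis by auto
  qed
  then show cov: "open_cover_of X \<U>"
    unfolding open_cover_of_def
  proof (intro conjI ballI)
    show "\<Union>\<U> = topspace X" using \<open>\<And>\<phi>. \<phi> \<in> ?X \<Longrightarrow> _\<close> by (auto simp: \<U>_def X_def)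
  qed (use op in \<open>unfold \<U>_def, blast\<close>)
  define c where "c k = std_char S (real k / 2 ^ n)" for k :: nat
  have lower: "2 ^ n \<le> card \<V>" if \<V>: "\<V> \<subseteq> iterated_cover X (T_map S) \<U> n" "finite \<V>" "\<Union>\<V> = topspace X" for \<V>
  proof -
    have "\<forall>k. \<exists>V\<in>\<V>. c k \<in> V" using \<V>(3) by (auto simp: c_def X_def)
    then obtain g where g: "\<And>k. g k \<in> \<V>" "\<And>k. c k \<in> g k" by metis
    have ne: "g j \<noteq> g k" if jk: "j < k" "k < 2 ^ n" for j k
    proof
      assume eq: "g j = g k"
      obtain i where i: "i < n" "(T_map S ^^ i) (c k) 1 = - (T_map S ^^ i) (c j) 1"
        using std_char_antipodal[OF jk] unfolding c_def by metis
      obtain U where U: "g j = {x \<in> topspace X. \<forall>i<n. (T_map S ^^ i) x \<in> U i}" "\<forall>i<n. U i \<in> \<U>"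
        using g(1)[of j] \<V>(1) unfolding iterated_cover_def by blast
      have "(T_map S ^^ i) (c j) \<in> U i" "(T_map S ^^ i) (c k) \<in> U i"
        using g(2)[of j] g(2)[of k] U(1) eq i(1) by auto
      moreover obtain w where "U i = {\<phi> \<in> ?X. Re (\<phi> 1 * w) > 0}"
        using U(2) i(1) unfolding \<U>_def by blast
      ultimately show False using i(2) by simp
    qed
    have "inj_on g {..<2 ^ n}"
      by (rule inj_onI) (metis lessThan_iff linorder_neqE_nat ne)
    then have "card {..<2 ^ n :: nat} \<le> card \<V>" using g(1) \<V>(2) by (intro card_inj_on_le[of g]) auto
    then show ?thesis by simp
  qed
  \<comment> \<open>A finite subcover exists by the upper bound, so the \<open>LEAST\<close> in
    \<open>subcover_number\<close> is attained by an actual subcover, to which \<open>lower\<close>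
    applies.\<close>
  have "\<exists>m. \<exists>\<V>. \<V> \<subseteq> iterated_cover X (T_map S) \<U> n \<and> finite \<V> \<and> card \<V> = m \<and> \<Union>\<V> = topspace X"
    using iterated_cover_small_subcover[OF cov[unfolded X_def]] unfolding X_def topspace_dual_topology by metis
  from LeastI_ex[OF this] lower show "2 ^ n \<le> subcover_number X (iterated_cover X (T_map S) \<U> n)"
    unfolding subcover_number_def by metis
qed

lemma entropy_T_eq: "entropy_T S = ln 2"
proof -
  let ?X = "dual_topology (R_ring S)"
  define \<U> where "\<U> = (\<lambda>w. {\<phi> \<in> characters (R_ring S). Re (\<phi> 1 * w) > 0}) ` {1, -1, \<i>, -\<i>}"
  have cov: "open_cover_of ?X \<U>" unfolding \<U>_def by (rule subcover_number_half_planes)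
  have "ereal (ln 2) \<le> cover_entropy ?X (T_map S) \<U>"
  proof -
    have "ln 2 \<le> ln (real (subcover_number ?X (iterated_cover ?X (T_map S) \<U> n))) / real n" if "n \<ge> 1" for n
    proof -
      have "real (2 ^ n) \<le> real (subcover_number ?X (iterated_cover ?X (T_map S) \<U> n))"
        using subcover_number_half_planes(2)[where S = S and n = n] unfolding \<U>_def of_nat_le_iff .
      then have "ln (2 ^ n) \<le> ln (real (subcover_number ?X (iterated_cover ?X (T_map S) \<U> n)))"
        by (intro ln_mono) auto
      then show ?thesis using that by (simp add: ln_realpow field_simps)
    qed
    then have "eventually (\<lambda>n. ereal (ln 2) \<le>
        ereal (ln (real (subcover_number ?X (iterated_cover ?X (T_map S) \<U> n))) / real n)) sequentially"
      by (intro eventually_sequentiallyI[of 1]) simp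
    then have "limsup (\<lambda>n. ereal (ln 2)) \<le> cover_entropy ?X (T_map S) \<U>"
      unfolding cover_entropy_def by (rule Limsup_mono)
    then show ?thesis by (simp add: Limsup_const)
  qed
  with cov have "ereal (ln 2) \<le> topological_entropy ?X (T_map S)"
    unfolding topological_entropy_def by (meson SUP_upper2 mem_Collect_eq)
  moreover have "topological_entropy ?X (T_map S) \<le> ereal (ln 2)"
    unfolding topological_entropy_def by (intro SUP_least) (auto intro: cover_entropy_le)
  ultimately have "topological_entropy ?X (T_map S) = ereal (ln 2)" by simp
  then show ?thesis by (simp add: entropy_T_def)
qed

section \<open>Periodic points and closed orbits\<close>

text \<open>A fixed character is trivial on all multiples of 2^n - 1. Since \<open>a\<close> is
  invertible in the ring, it is trivial on all multiples of \<open>b\<close>. The quotient of the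
  ring by \<open>b\<close> is generated by 1, because denominators are prime to \<open>b\<close>. So
  the character is determined by its value at 1, a \<open>b\<close>-th root of unity.\<close>

lemma periodic_points_T_map:
  assumes ab: "2 ^ n - 1 = a * b" and a: "supported_by S a" and b: "b > 0"
    and cop: "\<And>p. prime p \<Longrightarrow> p \<in> S \<Longrightarrow> \<not> p dvd b"
  defines "F \<equiv> {\<phi> \<in> characters (R_ring S). (T_map S ^^ n) \<phi> = \<phi>}"
  shows "finite F" "card F \<le> b"
proof -
  have one: "\<phi> (of_nat b * r) = 1" if "\<phi> \<in> F" "r \<in> R_ring S" for \<phi> r
  proof -
    have \<phi>: "\<phi> \<in> characters (R_ring S)" "(T_map S ^^ n) \<phi> = \<phi>" using that(1) by (auto simp: F_def)
    \<comment> \<open>Division by \<open>a\<close> stays inside the ring, and then (2^n - 1) s = b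
      r.\<close>
    define s where "s = r * (1 / of_nat a)"
    have s: "s \<in> R_ring S" unfolding s_def by (intro R_ring_mult that R_ring_inverse a)
    have bs: "of_nat b * r \<in> R_ring S" by (intro R_ring_mult that) auto
    have "a > 0" using a by (rule supported_by_pos)
    have "rat_of_nat (a * b) = 2 ^ n - 1" unfolding ab[symmetric] by (simp add: of_nat_diff)
    then have "2 ^ n * s = (rat_of_nat a * of_nat b + 1) * s" by simp
    then have "2 ^ n * s = of_nat b * (of_nat a * s) + s" by (simp only: algebra_simps)
    also have "of_nat a * s = r" using \<open>a > 0\<close> by (simp add: s_def)
    finally have "2 ^ n * s = of_nat b * r + s" .
    then have "\<phi> (2 ^ n * s) = \<phi> (of_nat b * r) * \<phi> s" using characters_add[OF \<phi>(1) bs s] by simp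
    moreover have "\<phi> (2 ^ n * s) = \<phi> s"
      using fun_cong[OF \<phi>(2), of s] s by (simp add: funpow_T_map[OF \<phi>(1)])
    moreover have "\<phi> s \<noteq> 0" using characters_norm[OF \<phi>(1) s] by auto
    ultimately show ?thesis by simp
  qed
  have img: "(\<lambda>\<phi>. \<phi> 1) ` F \<subseteq> {z. z ^ b = 1}"
  proof clarify
    fix \<phi> assume "\<phi> \<in> F"
    then show "\<phi> 1 ^ b = 1"
      using one[of \<phi> 1] characters_of_nat_mult[of \<phi> S 1 b] by (simp add: F_def)
  qed
  have inj: "inj_on (\<lambda>\<phi>. \<phi> 1) F"
  proof (rule inj_onI)
    fix \<phi> \<psi> assume F: "\<phi> \<in> F" "\<psi> \<in> F" and eq: "\<phi> 1 = \<psi> 1"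
    then have X: "\<phi> \<in> characters (R_ring S)" "\<psi> \<in> characters (R_ring S)" by (auto simp: F_def)
    show "\<phi> = \<psi>"
    proof (rule characters_eqI[OF X])
      fix r assume "r \<in> R_ring S"
      then obtain u v where v: "supported_by S v" "r = of_int u / of_nat v" unfolding R_ring_iff by blast
      have "coprime v b"
      proof (rule ccontr)
        assume "\<not> coprime v b"
        then have "gcd v b \<noteq> 1" by (simp only: coprime_iff_gcd_eq_1 not_False_eq_True)
        then obtain p where p: "prime p" "p dvd gcd v b" using prime_factor_nat by blast
        then have "p dvd v" "p dvd b" by simp_all
        with p(1) show False using v(1) cop unfolding supported_by_def by blast
      qed
      then have "coprime (int v) (int b)" by simp
      then obtain x y where xy: "x * int v + y * int b = 1"
        by (metis bezout_int coprime_iff_gcd_eq_1)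
      have "v > 0" using v(1) by (rule supported_by_pos)
      \<comment> \<open>Multiplying the Bezout identity by \<open>u / v\<close> writes
        \<open>r\<close> as an integer plus \<open>b\<close> times the ring element
        \<open>s\<close>.\<close>
      define s where "s = of_int (u * y) / rat_of_nat v"
      have s: "s \<in> R_ring S" unfolding s_def R_ring_iff using v(1) by blast
      have "rat_of_int (x * int v + y * int b) = 1" using xy by simp
      then have "rat_of_int x * of_nat v + of_int y * of_nat b = 1" by simp
      then have "of_int u / of_nat v * (rat_of_int x * of_nat v + of_int y * of_nat b) = of_int u / of_nat v" by simp
      then have r: "r = of_int (u * x) + of_nat b * s"
        using \<open>v > 0\<close> by (simp add: v(2) s_def algebra_simps)
      have bs: "of_nat b * s \<in> R_ring S" by (intro R_ring_mult s) auto
      have "\<phi> r = \<phi> (of_int (u * x) * 1)" "\<psi> r = \<psi> (of_int (u * x) * 1)"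
        unfolding r using one[OF F(1) s] one[OF F(2) s]
          characters_add[OF X(1) R_ring_of_int bs, of "u * x"] characters_add[OF X(2) R_ring_of_int bs, of "u * x"]
        by simp_all
      \<comment> \<open>The Lipschitz bound with distance 0 at 1 gives equality at every integer, of
        either sign.\<close>
      moreover have "norm (\<psi> (of_int (u * x) * 1) - \<phi> (of_int (u * x) * 1)) \<le> 0"
        using norm_character_diff_le[OF X R_ring_1, of "u * x"] eq by simp
      ultimately show "\<phi> r = \<psi> r" by simp
    qed
  qed
  have fin: "finite {z :: complex. z ^ b = 1}" using b by (intro finite_roots_unity) auto
  show "finite F" using inj img fin by (rule inj_on_finite)
  have "card F \<le> card {z :: complex. z ^ b = 1}" using inj img fin by (rule card_inj_on_le)
  also have "\<dots> \<le> b" using b by (intro card_roots_unity) auto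
  finally show "card F \<le> b" .
qed

section \<open>Counting closed orbits\<close>

text \<open>Exponents reduce modulo \<open>n\<close>, and from the point reached after
  \<open>j\<close> steps one is back at the start after \<open>n - j\<close> more. Thus any point
  generates the whole orbit, and two orbits that meet coincide.\<close>

lemma closed_orbit_eq_range:
  assumes "closed_orbit X T n \<tau>" "y \<in> \<tau>"
  shows "\<tau> = range (\<lambda>i. (T ^^ i) y)" "(T ^^ n) y = y"
proof -
  obtain x where x: "(T ^^ n) x = x" "\<tau> = (\<lambda>i. (T ^^ i) x) ` {0..n}" "card \<tau> = n"
    using assms(1) by (auto simp: closed_orbit_def)
  \<comment> \<open>For \<open>n = 0\<close> the image of \<open>{0..0}\<close> has one element, not
    0.\<close>
  have "n \<noteq> 0" using x by (cases n) auto
  obtain j where j: "y = (T ^^ j) x" "j \<le> n" using assms(2) x(2) by auto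
  have \<tau>: "\<tau> = range (\<lambda>i. (T ^^ i) x)"
  proof -
    have "(T ^^ i) x \<in> \<tau>" for i
    proof -
      have "(T ^^ i) x = (T ^^ (i mod n)) x" using funpow_mod_eq[OF x(1)] by simp
      moreover have "i mod n \<in> {0..n}" using \<open>n \<noteq> 0\<close> by (simp add: less_imp_le)
      ultimately show ?thesis unfolding x(2) by blast
    qed
    then show ?thesis using x(2) by auto
  qed
  have Ty: "(T ^^ i) y = (T ^^ (i + j)) x" for i by (simp add: j funpow_add)
  show "(T ^^ n) y = y"
    unfolding Ty j(1) by (metis add.commute comp_apply funpow_add x(1))
  have "(T ^^ i) x = (T ^^ (i + (n - j))) y" for i
  proof -
    have "(T ^^ (i + (n - j))) y = (T ^^ (i + n)) x" unfolding Ty using j(2) by simp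
    then show ?thesis using x(1) by (simp add: funpow_add)
  qed
  then show "\<tau> = range (\<lambda>i. (T ^^ i) y)" unfolding \<tau> using Ty by auto
qed

text \<open>The orbits of length \<open>n\<close> are disjoint sets of \<open>n\<close> points, all
  fixed by the \<open>n\<close>-th iterate. Only an inequality results, since points of smaller
  period are fixed as well.\<close>

lemma closed_orbits_count:
  assumes "finite {x \<in> X. (T ^^ n) x = x}" "\<And>x i. x \<in> X \<Longrightarrow> (T ^^ i) x \<in> X"
  shows "finite {\<tau>. closed_orbit X T n \<tau>}"
    and "n * card {\<tau>. closed_orbit X T n \<tau>} \<le> card {x \<in> X. (T ^^ n) x = x}"
proof -
  let ?C = "{\<tau>. closed_orbit X T n \<tau>}" and ?P = "{x \<in> X. (T ^^ n) x = x}"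
  have sub: "\<tau> \<subseteq> ?P" if "closed_orbit X T n \<tau>" for \<tau>
    using that closed_orbit_eq_range(2)[OF that] assms(2) by (auto simp: closed_orbit_def)
  then have "?C \<subseteq> Pow ?P" by auto
  with assms(1) show fin: "finite ?C" by (meson finite_Pow_iff finite_subset)
  have "disjoint ?C"
    by (rule disjointI) (metis closed_orbit_eq_range(1) disjoint_iff mem_Collect_eq)
  then have "card (\<Union>?C) = sum card ?C"
    using finite_subset[OF sub assms(1)] by (intro card_Union_disjoint) auto
  also have "\<dots> = (\<Sum>\<tau>\<in>?C. n)" by (intro sum.cong) (auto simp: closed_orbit_def)
  also have "\<dots> = n * card ?C" by simp
  finally have "n * card ?C = card (\<Union>?C)" ..
  also have "\<dots> \<le> card ?P" using sub assms(1) by (intro card_mono) auto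
  finally show "n * card ?C \<le> card ?P" .
qed

text \<open>The cardinality of an orbit is its length, so the orbits split into disjoint classes by
  length, and with entropy \<open>ln 2\<close> an orbit of length \<open>n\<close> has weight 1 /
  2^n. Finiteness of the classes is needed to split the sum.\<close>

lemma M_sum_eq:
  assumes "\<And>n. n \<ge> 1 \<Longrightarrow> finite {\<tau>. closed_orbit (characters (R_ring S)) (T_map S) n \<tau>}"
  shows "M_sum S N = (\<Sum>n=1..N. real (card {\<tau>. closed_orbit (characters (R_ring S)) (T_map S) n \<tau>}) / 2 ^ n)"
proof -
  define C where "C n = {\<tau>. closed_orbit (characters (R_ring S)) (T_map S) n \<tau>}" for n
  have card: "card \<tau> = n" if "\<tau> \<in> C n" for \<tau> n using that by (auto simp: C_def closed_orbit_def)
  have "C 0 = {}" by (auto simp: C_def closed_orbit_def)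
  then have "{\<tau>. \<exists>n\<le>N. closed_orbit (characters (R_ring S)) (T_map S) n \<tau>} = (\<Union>n\<in>{1..N}. C n)"
    unfolding C_def by auto (metis One_nat_def Suc_leI atLeastAtMost_iff bot_nat_0.not_eq_extremum)
  then have "M_sum S N = (\<Sum>\<tau>\<in>(\<Union>n\<in>{1..N}. C n). exp (- ln 2 * real (card \<tau>)))"
    by (simp add: M_sum_def entropy_T_eq)
  also have "\<dots> = (\<Sum>n=1..N. \<Sum>\<tau>\<in>C n. exp (- ln 2 * real (card \<tau>)))"
  proof (intro sum.UNION_disjoint ballI impI)
    show "finite (C n)" if "n \<in> {1..N}" for n using assms[of n] that by (simp add: C_def)
    show "C i \<inter> C j = {}" if "i \<noteq> j" for i j using card that by blast
  qed simp
  also have "\<dots> = (\<Sum>n=1..N. real (card (C n)) / 2 ^ n)"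
  proof (rule sum.cong[OF refl])
    fix n
    have "(\<Sum>\<tau>\<in>C n. exp (- ln 2 * real (card \<tau>))) = (\<Sum>\<tau>\<in>C n. 1 / 2 ^ n :: real)"
      by (intro sum.cong refl) (simp add: card exp_minus exp_of_nat2_mult inverse_eq_divide)
    then show "(\<Sum>\<tau>\<in>C n. exp (- ln 2 * real (card \<tau>))) = real (card (C n)) / 2 ^ n" by simp
  qed
  finally show ?thesis unfolding C_def .
qed

section \<open>Convergence with error \<open>O(1 / N)\<close>\<close>

text \<open>The terms are dominated by the telescoping 1 / (M (M + 1)) = 1 / M - 1 / (M + 1), so the
  increasing partial sums exceed the one at \<open>N\<close> by at most \<open>1 / N\<close>, and so
  does their limit.\<close>

lemma partial_sums_inverse_squares_bigo:
  fixes a :: "nat \<Rightarrow> real"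
  assumes "\<And>n. n \<ge> 1 \<Longrightarrow> 0 \<le> a n" "\<And>n. n \<ge> 1 \<Longrightarrow> a n \<le> 1 / real n ^ 2"
  shows "\<exists>C. (\<lambda>N. (\<Sum>n=1..N. a n) - C) \<in> O(\<lambda>N. 1 / real N)"
proof -
  define s where "s N = (\<Sum>n=1..N. a n)" for N
  have step: "s M \<le> s N + 1 / real N - 1 / real M" if "N \<ge> 1" "M \<ge> N" for N M
    using that(2)
  proof (induction M rule: dec_induct)
    case (step M)
    have M: "M \<ge> 1" using step that by simp
    have "a (Suc M) \<le> 1 / real (Suc M) ^ 2" by (rule assms(2)) simp
    also have "\<dots> \<le> 1 / (real M * real (Suc M))"
      using M by (intro divide_left_mono) (auto simp: power2_eq_square)
    also have "\<dots> = 1 / real M - 1 / real (Suc M)" using M by (simp add: field_simps)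
    finally show ?case using step.IH by (simp add: s_def)
  qed simp
  have inc: "incseq s" unfolding s_def by (rule incseq_SucI) (simp add: assms(1))
  have le: "s M \<le> s N + 1 / real N" if "N \<ge> 1" for N M
  proof (cases "M \<ge> N")
    case True
    then show ?thesis using step[OF that True] by (smt (verit) divide_nonneg_nonneg of_nat_0_le_iff)
  next
    case False
    then have "s M \<le> s N" using inc by (simp add: incseq_def)
    then show ?thesis by (simp add: add_increasing2)
  qed
  obtain C where C: "s \<longlonglongrightarrow> C" "\<And>i. s i \<le> C"
    using incseq_convergent[OF inc, of "s 1 + 1 / real 1"] le[of 1] by auto
  have "norm (s N - C) \<le> 1 * norm (1 / real N)" if "N \<ge> 1" for N
  proof -
    have "C \<le> s N + 1 / real N" using le[OF that] by (intro LIMSEQ_le_const2[OF C(1)]) auto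
    then show ?thesis using C(2)[of N] by simp
  qed
  then have "(\<lambda>N. s N - C) \<in> O(\<lambda>N. 1 / real N)"
    by (intro bigoI[of _ 1] eventually_sequentiallyI[of 1]) simp
  then show ?thesis unfolding s_def by blast
qed

lemma M_sum_asymptotics:
  assumes "\<And>n. n \<ge> 1 \<Longrightarrow> \<exists>a b. 2 ^ n - 1 = a * b \<and> supported_by S a \<and> n \<le> a \<and>
      (\<forall>p. prime p \<longrightarrow> p \<in> S \<longrightarrow> \<not> p dvd b)"
  shows "\<exists>C. (\<lambda>N. M_sum S N - C) \<in> O(\<lambda>N. 1 / real N)"
proof -
  let ?C = "\<lambda>n. {\<tau>. closed_orbit (characters (R_ring S)) (T_map S) n \<tau>}"
  have *: "finite (?C n) \<and> real (card (?C n)) / 2 ^ n \<le> 1 / real n ^ 2" if n: "n \<ge> 1" for n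
  proof -
    obtain a b where ab: "2 ^ n - 1 = a * b" "supported_by S a" "n \<le> a" "\<And>p. prime p \<Longrightarrow> p \<in> S \<Longrightarrow> \<not> p dvd b"
      using assms[OF n] by blast
    have "(2::nat) ^ n > 1" using n by (intro one_less_power) auto
    then have "b > 0" using ab(1) by (cases "b = 0") auto
    note P = periodic_points_T_map[OF ab(1,2) \<open>b > 0\<close> ab(4)]
    note C = closed_orbits_count[OF P(1) funpow_T_map_in_characters]
    \<comment> \<open>One factor \<open>n\<close> comes from \<open>n \<le> a\<close>, the other
      from the \<open>n\<close> points on each orbit.\<close>
    have "n * (n * card (?C n)) \<le> a * b" using ab(3) C(2) P(2) by (intro mult_mono) auto
    also have "\<dots> \<le> 2 ^ n" unfolding ab(1)[symmetric] by simp
    finally have "real (n * (n * card (?C n))) \<le> real (2 ^ n)" by (simp only: of_nat_le_iff)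
    then have "real (card (?C n)) / 2 ^ n \<le> 1 / real n ^ 2"
      using n by (simp add: field_simps power2_eq_square)
    with C(1) show ?thesis by blast
  qed
  have "M_sum S N = (\<Sum>n=1..N. real (card (?C n)) / 2 ^ n)" for N
    using * by (intro M_sum_eq) blast
  then show ?thesis
    using partial_sums_inverse_squares_bigo[of "\<lambda>n. real (card (?C n)) / 2 ^ n"] * by simp
qed

section \<open>Colourings that split two matchings\<close>

text \<open>
  With \<open>\<sigma> = g \<circ> f\<close>, the group generated by \<open>f\<close> and \<open>g\<close> is dihedral and each of its orbits consists of
  the orbits of \<open>x\<close> and \<open>g x\<close> under \<open>\<sigma>\<close>. They are disjoint: \<open>g x = \<sigma>^k x\<close> would yield a fixed
  point of \<open>g\<close> (\<open>k\<close> even) or of \<open>f\<close> (\<open>k\<close> odd). Colour one of them.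
\<close>
lemma fixpoint_free_involutions_2_colouring:
  fixes f g :: "'a \<Rightarrow> 'a"
  assumes ff: "\<And>x. f (f x) = x" "\<And>x. f x \<noteq> x" and gg: "\<And>x. g (g x) = x" "\<And>x. g x \<noteq> x"
  obtains c :: "'a \<Rightarrow> bool" where "\<And>x. c (f x) \<noteq> c x" "\<And>x. c (g x) \<noteq> c x"
proof -
  define \<sigma> where "\<sigma> x = g (f x)" for x
  have inj: "inj \<sigma>" unfolding \<sigma>_def by (rule injI) (metis ff(1) gg(1))
  have surj: "surj \<sigma>" unfolding \<sigma>_def by (rule surjI[of _ "\<lambda>y. f (g y)"]) (simp add: ff gg)
  have injn: "(\<sigma> ^^ n) x = (\<sigma> ^^ n) y \<longleftrightarrow> x = y" for n x y
    using inj_fn[OF inj, of n] by (auto simp: inj_def)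
  have surjn: "\<exists>y. x = (\<sigma> ^^ n) y" for n x
    using surj_fn[OF surj, of n] by (metis surjD)
  \<comment> \<open>The dihedral relation: \<open>g\<close> conjugates \<sigma> to its inverse,
    stated with forward iterates only.\<close>
  have \<sigma>g: "(\<sigma> ^^ n) (g ((\<sigma> ^^ n) x)) = g x" for n x
  proof (induction n)
    case (Suc n)
    have "(\<sigma> ^^ Suc n) (g ((\<sigma> ^^ Suc n) x)) = (\<sigma> ^^ n) (\<sigma> (g (\<sigma> ((\<sigma> ^^ n) x))))"
      by (simp add: funpow_swap1)
    also have "\<sigma> (g (\<sigma> y)) = g y" for y by (simp add: \<sigma>_def ff gg)
    finally show ?case using Suc by simp
  qed simp
  have ne: "(\<sigma> ^^ k) z \<noteq> g z" for k z
  proof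
    assume eq: "(\<sigma> ^^ k) z = g z"
    define j where "j = k div 2"
    define w where "w = (\<sigma> ^^ j) z"
    show False
    proof (cases "even k")
      case True
      then have "k = j + j" by (simp add: j_def flip: mult_2)
      then have "(\<sigma> ^^ j) w = (\<sigma> ^^ j) (g w)" using eq \<sigma>g[of j z] by (simp add: funpow_add w_def)
      then show False using gg(2) by (metis injn)
    next
      case False
      then have "k = j + Suc j" by (simp add: j_def) presburger
      then have "(\<sigma> ^^ k) z = (\<sigma> ^^ j) (\<sigma> w)" by (simp only: funpow_add comp_apply funpow.simps(2) w_def)
      then have "(\<sigma> ^^ j) (\<sigma> w) = (\<sigma> ^^ j) (g w)" using eq \<sigma>g[of j z] unfolding w_def by metis
      then have "g (f w) = g w" by (simp add: injn \<sigma>_def)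
      then show False using ff(2) gg(1) by metis
    qed
  qed
  have comm: "(\<sigma> ^^ m) ((\<sigma> ^^ n) w) = (\<sigma> ^^ n) ((\<sigma> ^^ m) w)" for m n w
    by (metis add.commute comp_apply funpow_add)
  \<comment> \<open>Being in the same orbit of the bijection \<sigma>, again without negative
    iterates.\<close>
  define R where "R x y \<longleftrightarrow> (\<exists>m n. (\<sigma> ^^ m) x = (\<sigma> ^^ n) y)" for x y
  have refl: "R x x" for x unfolding R_def by blast
  have sym: "R x y \<longleftrightarrow> R y x" for x y unfolding R_def by metis
  have trans: "R x z" if xy: "R x y" and yz: "R y z" for x y z
  proof -
    obtain a b where ab: "(\<sigma> ^^ a) x = (\<sigma> ^^ b) y" using xy unfolding R_def by blast
    obtain k d where kd: "(\<sigma> ^^ k) y = (\<sigma> ^^ d) z" using yz unfolding R_def by blast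
    have "(\<sigma> ^^ (k + a)) x = (\<sigma> ^^ k) ((\<sigma> ^^ b) y)" by (simp add: funpow_add ab)
    also have "\<dots> = (\<sigma> ^^ b) ((\<sigma> ^^ d) z)" using comm[of k b y] kd by simp
    also have "\<dots> = (\<sigma> ^^ (b + d)) z" by (simp add: funpow_add)
    finally have "(\<sigma> ^^ (k + a)) x = (\<sigma> ^^ (b + d)) z" .
    then show ?thesis unfolding R_def by blast
  qed
  have Rg: "R (g x) (g y)" if xy: "R x y" for x y
  proof -
    obtain m n where mn: "(\<sigma> ^^ m) x = (\<sigma> ^^ n) y" using xy unfolding R_def by blast
    have "(\<sigma> ^^ n) (g x) = (\<sigma> ^^ n) ((\<sigma> ^^ m) (g ((\<sigma> ^^ n) y)))"
      using \<sigma>g[of m x] mn by simp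
    also have "\<dots> = (\<sigma> ^^ m) ((\<sigma> ^^ n) (g ((\<sigma> ^^ n) y)))"
      by (rule comm)
    also have "\<dots> = (\<sigma> ^^ m) (g y)" by (simp add: \<sigma>g)
    finally show ?thesis unfolding R_def by blast
  qed
  have notR: "\<not> R x (g x)" for x
  proof
    assume "R x (g x)"
    then obtain m n where mn: "(\<sigma> ^^ m) x = (\<sigma> ^^ n) (g x)" unfolding R_def by blast
    \<comment> \<open>Pulling \<open>x\<close> back by \<sigma>^n moves all iterates to one side,
      which reduces the claim to \<open>ne\<close>.\<close>
    obtain y where "x = (\<sigma> ^^ n) y" using surjn by blast
    then have "(\<sigma> ^^ (m + n)) y = g y" using mn \<sigma>g[of n y] by (simp add: funpow_add)
    then show False using ne by blast
  qed
  define Orb where "Orb x = {y. R x y \<or> R (g x) y}" for x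
  \<comment> \<open>The chosen point depends only on the set \<open>Orb x\<close>, so all points of
    a dihedral orbit share it; the colour tells whether a point lies in the same \<sigma>-orbit as
    this representative.\<close>
  define r where "r x = (SOME y. y \<in> Orb x)" for x
  define c where "c x = R x (r x)" for x
  have "x \<in> Orb x" for x by (simp add: Orb_def refl)
  then have r: "R x (r x) \<or> R (g x) (r x)" for x unfolding r_def by (metis (no_types, lifting) Orb_def mem_Collect_eq someI)
  have g: "c (g x) \<noteq> c x" for x
  proof -
    have "Orb (g x) = Orb x" by (auto simp: Orb_def gg)
    then have "r (g x) = r x" by (simp add: r_def)
    then have "c (g x) = R (g x) (r x)" by (simp add: c_def)
    then show ?thesis using r[of x] notR[of x] sym trans unfolding c_def by metis
  qed
  have f: "c (f x) \<noteq> c x" for x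
  proof -
    have "R x (\<sigma> x)" unfolding R_def by (metis funpow_0 funpow_simps_right(2) comp_apply)
    then have "R x y \<longleftrightarrow> R (\<sigma> x) y" "R (g x) y \<longleftrightarrow> R (g (\<sigma> x)) y" for y
      using Rg sym trans by metis+
    then have "c (\<sigma> x) = c x" by (simp add: c_def r_def Orb_def)
    \<comment> \<open>Since \<sigma> preserves the colour and \<open>g\<close> flips it, their
      composite \<open>f\<close> flips it too.\<close>
    moreover have "f x = g (\<sigma> x)" by (simp add: \<sigma>_def gg)
    ultimately show ?thesis using g[of "\<sigma> x"] by simp
  qed
  show ?thesis using that f g by blast
qed

text \<open>Fixed points are removed by letting the involutions exchange two copies of them.\<close>
lemma involutions_2_colouring:
  fixes f g :: "'a \<Rightarrow> 'a"
  assumes "\<And>x. f (f x) = x" "\<And>x. g (g x) = x"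
  shows "\<exists>c :: 'a \<Rightarrow> bool. (\<forall>x. f x \<noteq> x \<longrightarrow> c (f x) \<noteq> c x) \<and> (\<forall>x. g x \<noteq> x \<longrightarrow> c (g x) \<noteq> c x)"
proof -
  define lift where "lift h z = (if h (fst z) = fst z then (fst z, \<not> snd z) else (h (fst z), snd z))"
    for h :: "'a \<Rightarrow> 'a" and z :: "'a \<times> bool"
  have invol: "lift h (lift h z) = z" if "\<And>x. h (h x) = x" for h z
    using that by (cases z) (auto simp: lift_def)
  have free: "lift h z \<noteq> z" for h z by (cases z) (auto simp: lift_def)
  obtain c :: "'a \<times> bool \<Rightarrow> bool"
    where c: "\<And>z. c (lift f z) \<noteq> c z" "\<And>z. c (lift g z) \<noteq> c z"
    using fixpoint_free_involutions_2_colouring[OF invol[OF assms(1)] free invol[OF assms(2)] free] by blast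
  show ?thesis
  proof (intro exI[of _ "\<lambda>x. c (x, True)"] conjI allI impI)
    show "c (f x, True) \<noteq> c (x, True)" if "f x \<noteq> x" for x
      using c(1)[of "(x, True)"] that by (simp add: lift_def)
    show "c (g x, True) \<noteq> c (x, True)" if "g x \<noteq> x" for x
      using c(2)[of "(x, True)"] that by (simp add: lift_def)
  qed
qed

section \<open>Counting primes\<close>

definition prime_count :: "real \<Rightarrow> nat" where
  "prime_count x = card {p::nat. prime p \<and> real p \<le> x}"

lemma finite_primes_le [simp]: "finite {p::nat. prime p \<and> real p \<le> x}"
  by (rule finite_subset[of _ "{..nat \<lfloor>x\<rfloor>}"]) (auto simp: le_nat_floor)

abbreviation nth_prime :: "nat \<Rightarrow> nat" where
  "nth_prime \<equiv> enumerate {p. prime p}"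

text \<open>The enumeration is increasing, so the indices of the primes up to \<open>x\<close> form
  a finite down-closed set, which is an initial segment.\<close>

lemma primes_le_eq_image: "{p::nat. prime p \<and> real p \<le> x} = nth_prime ` {..<prime_count x}"
proof -
  define M where "M = {i. real (nth_prime i) \<le> x}"
  have img: "{p::nat. prime p \<and> real p \<le> x} = nth_prime ` M"
  proof (intro equalityI subsetI)
    fix p assume p: "p \<in> {p. prime p \<and> real p \<le> x}"
    then obtain i where "nth_prime i = p" using enumerate_Ex[OF primes_infinite] by blast
    with p show "p \<in> nth_prime ` M" by (auto simp: M_def)
  next
    fix p assume "p \<in> nth_prime ` M"
    then show "p \<in> {p. prime p \<and> real p \<le> x}"
      using enumerate_in_set[OF primes_infinite] by (auto simp: M_def)
  qed
  have inj: "inj nth_prime"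
    using bij_enumerate[OF primes_infinite] by (simp add: bij_betw_def)
  have "finite (nth_prime ` M)" using finite_primes_le[of x] img by simp
  then have fin: "finite M" using inj by (metis finite_imageD inj_on_subset subset_UNIV)
  have down: "i \<in> M" if "j \<in> M" "i \<le> j" for i j
    using that enumerate_mono_le_iff[OF primes_infinite, of i j] by (simp add: M_def)
  have "M = {..<card M}"
  proof (rule card_subset_eq[symmetric])
    show "{..<card M} \<subseteq> M"
    proof
      fix i assume i: "i \<in> {..<card M}"
      show "i \<in> M"
      proof (rule ccontr)
        assume "i \<notin> M"
        then have "M \<subseteq> {..<i}" using down by (meson lessThan_iff linorder_not_le subsetI)
        then have "card M \<le> i" using card_mono[of "{..<i}" M] by simp
        with i show False by simp
      qed
    qed
  qed (use fin in auto)
  moreover have "prime_count x = card M"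
    unfolding prime_count_def img by (rule card_image) (meson inj inj_on_subset subset_UNIV)
  ultimately show ?thesis using img by simp
qed

section \<open>Density of a colour class that splits consecutive pairs\<close>

text \<open>Each pair of indices \<open>2 * j\<close> and \<open>2 * j + 1\<close> contributes
  exactly one, and at most one index is left unpaired.\<close>

lemma card_alternating:
  assumes "\<And>j. P (Suc (2 * j)) \<longleftrightarrow> \<not> P (2 * j)"
  shows "\<bar>2 * int (card {i. i < m \<and> P i}) - int m\<bar> \<le> 1"
proof -
  have Suc: "card {i. i < Suc m \<and> P i} = card {i. i < m \<and> P i} + (if P m then 1 else 0)" for m
  proof -
    have "{i. i < Suc m \<and> P i} = (if P m then insert m {i. i < m \<and> P i} else {i. i < m \<and> P i})"
      by (auto simp: less_Suc_eq)
    then show ?thesis by simp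
  qed
  have even: "card {i. i < 2 * j \<and> P i} = j" for j
    by (induction j) (simp_all add: Suc assms)
  show ?thesis
  proof (cases "even m")
    case True
    then show ?thesis using even[of "m div 2"] by simp
  next
    case False
    then obtain j where "m = Suc (2 * j)" by (metis oddE Suc_eq_plus1)
    then show ?thesis using even[of j] Suc[of "2 * j"] by simp
  qed
qed

text \<open>Up to \<open>x\<close> the colour class differs from half of the primes by at most 1/2,
  and adding the sparse set \<open>E\<close> does not change the limit.\<close>

lemma has_prime_density_half:
  fixes c :: "nat \<Rightarrow> bool"
  assumes alt: "\<And>j. c (nth_prime (Suc (2 * j))) \<longleftrightarrow> \<not> c (nth_prime (2 * j))"
    and E: "E \<subseteq> {p. prime p}"
    and sparse: "((\<lambda>x. real (card {p \<in> E. real p \<le> x}) / real (prime_count x)) \<longlongrightarrow> 0) at_top"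
    and inf: "filterlim (\<lambda>x. real (prime_count x)) at_top at_top"
  shows "has_prime_density ({p. prime p \<and> c p} \<union> E) (1/2)"
proof -
  let ?S = "{p. prime p \<and> c p} \<union> E"
  have inj: "inj nth_prime"
    using bij_enumerate[OF primes_infinite] by (simp add: bij_betw_def)
  have fin: "finite {p \<in> A. prime p \<and> real p \<le> x}" for A :: "nat set" and x
    by (rule finite_subset[OF _ finite_primes_le[of x]]) auto
  have bounds: "real (prime_count x) - 1 \<le> 2 * real (card {p \<in> ?S. prime p \<and> real p \<le> x})"
    "2 * real (card {p \<in> ?S. prime p \<and> real p \<le> x}) \<le> real (prime_count x) + 1 + 2 * real (card {p \<in> E. real p \<le> x})"
    for x
  proof -
    define A where "A = {p. prime p \<and> real p \<le> x \<and> c p}"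
    have "A = {p. prime p \<and> real p \<le> x} \<inter> {p. c p}" by (auto simp: A_def)
    then have "A = nth_prime ` {i. i < prime_count x \<and> c (nth_prime i)}"
      unfolding primes_le_eq_image by auto
    then have "card A = card {i. i < prime_count x \<and> c (nth_prime i)}"
      by (metis card_image inj inj_on_subset subset_UNIV)
    then have A: "\<bar>2 * real (card A) - real (prime_count x)\<bar> \<le> 1"
      using card_alternating[of "\<lambda>i. c (nth_prime i)" "prime_count x", OF alt] by linarith
    have "A \<subseteq> {p \<in> ?S. prime p \<and> real p \<le> x}" by (auto simp: A_def)
    from card_mono[OF fin this] A
    show "real (prime_count x) - 1 \<le> 2 * real (card {p \<in> ?S. prime p \<and> real p \<le> x})" by linarith
    have "{p \<in> ?S. prime p \<and> real p \<le> x} = A \<union> {p \<in> E. real p \<le> x}" using E by (auto simp: A_def)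
    then have "card {p \<in> ?S. prime p \<and> real p \<le> x} \<le> card A + card {p \<in> E. real p \<le> x}"
      by (metis card_Un_le)
    with A show "2 * real (card {p \<in> ?S. prime p \<and> real p \<le> x})
        \<le> real (prime_count x) + 1 + 2 * real (card {p \<in> E. real p \<le> x})" by linarith
  qed
  have inv: "((\<lambda>x. 1 / real (prime_count x)) \<longlongrightarrow> 0) at_top"
    using tendsto_inverse_0_at_top[OF inf] by (simp add: inverse_eq_divide)
  have pos: "eventually (\<lambda>x. real (prime_count x) > 0) at_top"
    using inf unfolding filterlim_at_top_dense by blast
  show ?thesis
    unfolding has_prime_density_def prime_count_def[symmetric]
  proof (rule tendsto_sandwich)
    show "((\<lambda>x. 1/2 - (1 / real (prime_count x)) / 2) \<longlongrightarrow> 1/2) at_top"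
      by (rule tendsto_eq_intros inv refl | simp)+
    show "((\<lambda>x. 1/2 + (1 / real (prime_count x)) / 2 + real (card {p \<in> E. real p \<le> x}) / real (prime_count x))
        \<longlongrightarrow> 1/2) at_top"
      by (rule tendsto_eq_intros inv sparse refl | simp)+
    show "\<forall>\<^sub>F x in at_top. 1/2 - (1 / real (prime_count x)) / 2 \<le>
        real (card {p \<in> ?S. prime p \<and> real p \<le> x}) / real (prime_count x)"
      using pos
    proof eventually_elim
      case (elim x)
      have "(real (prime_count x) - 1) / 2 / real (prime_count x) \<le>
          real (card {p \<in> ?S. prime p \<and> real p \<le> x}) / real (prime_count x)"
        using bounds(1)[of x] by (intro divide_right_mono) auto
      moreover have "(real (prime_count x) - 1) / 2 / real (prime_count x) = 1/2 - (1 / real (prime_count x)) / 2"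
        using elim by (simp add: field_simps)
      ultimately show ?case by simp
    qed
    show "\<forall>\<^sub>F x in at_top. real (card {p \<in> ?S. prime p \<and> real p \<le> x}) / real (prime_count x) \<le>
        1/2 + (1 / real (prime_count x)) / 2 + real (card {p \<in> E. real p \<le> x}) / real (prime_count x)"
      using pos
    proof eventually_elim
      case (elim x)
      have "s / a \<le> 1/2 + (1 / a) / 2 + e / a" if "2 * s \<le> a + 1 + 2 * e" "a > 0" for s a e :: real
        using that by (simp add: field_simps)
      from this[OF bounds(2) elim] show ?case .
    qed
  qed
qed

section \<open>Chebyshev's lower bound for the number of primes\<close>

text \<open>Follows the recurrence of Leibniz' harmonic triangle.\<close>
lemma mult_binomial_dvd:
  fixes L :: nat
  assumes "1 \<le> m" "m \<le> n" "\<And>k. 1 \<le> k \<Longrightarrow> k \<le> n \<Longrightarrow> k dvd L"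
  shows "m * (n choose m) dvd L"
proof -
  have "\<exists>z::int. real L / real (m * (n choose m)) = of_int z"
    using assms
  proof (induction m arbitrary: n rule: dec_induct)
    case base
    then obtain k where "L = n * k" by (meson dvdE order_refl)
    then show ?case using base by (intro exI[of _ "int k"]) simp
  next
    case (step m)
    from step.prems have n: "m < n" by simp
    have "m \<le> n" "m \<le> n - 1" "\<And>k. 1 \<le> k \<Longrightarrow> k \<le> n - 1 \<Longrightarrow> k dvd L"
      using n step.prems(2) by auto
    then obtain y z :: int where yz: "real L / real (m * (n choose m)) = of_int y"
      "real L / real (m * ((n - 1) choose m)) = of_int z"
      using step.IH[of n] step.IH[of "n - 1"] step.prems(2) by blast
    have X: "real ((n - 1) choose m) > 0" using n by simp
    have 1: "real (n - m) * real (n choose m) = real n * real ((n - 1) choose m)"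
      using binomial_absorb_comp[of n m] by (metis of_nat_mult)
    have 2: "real (Suc m) * real (n choose Suc m) = real n * real ((n - 1) choose m)"
      using binomial_absorption[of m n] by (metis of_nat_mult)
    have "real L / real (Suc m * (n choose Suc m)) = real L / (real n * real ((n - 1) choose m))"
      by (simp only: 2 of_nat_mult)
    \<comment> \<open>The cancelling factor \<open>n - m\<close> lets fact \<open>1\<close> express
      both terms through \<open>(n - 1) choose m\<close>. By induction both terms are
      integers.\<close>
    also have "\<dots> = real L / (real m * real ((n - 1) choose m)) -
        real L * real (n - m) / (real m * (real (n - m) * real (n choose m)))"
      unfolding 1 using X n step.hyps by (simp add: field_simps of_nat_diff)
    also have "\<dots> = of_int (z - y)" using yz n by simp
    finally show ?case by blast
  qed
  then obtain z :: int where "real L / real (m * (n choose m)) = of_int z" by blast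
  moreover have "m * (n choose m) > 0" using assms by simp
  ultimately have "real L = real (m * (n choose m)) * of_int z" by (simp add: field_simps)
  then have "int L = int (m * (n choose m)) * z" by (metis of_int_eq_iff of_int_mult of_int_of_nat_eq)
  then show ?thesis by (metis dvd_triv_left int_dvd_int_iff)
qed

text \<open>The witness is the least common multiple of the numbers up to \<open>n\<close>: the
  product over the primes \<open>p \<le> n\<close> of the largest power of \<open>p\<close> not
  above \<open>n\<close>. Each of these factors is at most \<open>n\<close>.\<close>

lemma ex_common_multiple_le_power_primes:
  obtains L :: nat where "L > 0" "\<And>k. 1 \<le> k \<Longrightarrow> k \<le> n \<Longrightarrow> k dvd L"
    "L \<le> n ^ card {p. prime p \<and> p \<le> n}"
proof -
  define e where "e p = (GREATEST k. p ^ k \<le> n)" for p :: nat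
  define L where "L = (\<Prod>p | prime p \<and> p \<le> n. p ^ e p)"
  have bound: "k \<le> n" if "prime p" "p ^ k \<le> n" for p k :: nat
    using that power_gt_expt[of p k] prime_gt_1_nat[of p] by simp
  have e: "p ^ e p \<le> n" if "prime p" "p \<le> n" for p
    unfolding e_def using that bound[OF that(1)]
    by (intro GreatestI_nat[of "\<lambda>k. p ^ k \<le> n" 0 n]) (auto simp: Suc_le_eq intro: prime_gt_0_nat less_le_trans)
  have le_e: "k \<le> e p" if "prime p" "p ^ k \<le> n" for p k
    unfolding e_def using that bound[OF that(1)] by (intro Greatest_le_nat[of _ k n]) auto
  have "k dvd L" if "1 \<le> k" "k \<le> n" for k
  proof -
    have "k = (\<Prod>p \<in> prime_factors k. p ^ multiplicity p k)" using that by (intro prime_factorization_nat) simp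
    also have "\<dots> dvd L"
      unfolding L_def
    proof (rule prod_dvd_prod_subset2)
      show "prime_factors k \<subseteq> {p. prime p \<and> p \<le> n}"
        using that by (auto simp: in_prime_factors_iff dest!: dvd_imp_le)
      fix p assume "p \<in> prime_factors k"
      then have "prime p" by auto
      moreover have "p ^ multiplicity p k \<le> n"
        using that multiplicity_dvd[of p k] by (meson dvd_imp_le le_trans less_le_trans zero_less_one)
      ultimately show "p ^ multiplicity p k dvd p ^ e p" by (intro le_imp_power_dvd le_e)
    qed simp
    finally show ?thesis .
  qed
  moreover have "L \<le> (\<Prod>p | prime p \<and> p \<le> n. n)" unfolding L_def by (intro prod_mono) (auto intro: e)
  moreover have "L > 0" unfolding L_def by (intro prod_pos) (auto intro: prime_gt_0_nat)
  ultimately show ?thesis using that by simp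
qed

text \<open>The number \<open>m * (2 * m choose m)\<close> is at least 4^m / 2 and divides every
  common multiple of the numbers up to \<open>2 * m\<close>, one of which is at most
  \<open>2 * m\<close> to the number of primes up to \<open>2 * m\<close>. Compare
  logarithms.\<close>

lemma prime_count_ge:
  assumes "x \<ge> 4"
  shows "(x - 3) * ln 2 / ln x \<le> real (prime_count x)"
proof -
  define m where "m = nat \<lfloor>x / 2\<rfloor>"
  have m: "2 * real m \<le> x" "x - 2 < 2 * real m" using assms unfolding m_def by linarith+
  then have "m \<ge> 1" using assms by linarith
  let ?P = "{p. prime p \<and> p \<le> 2 * m}"
  obtain L where L: "L > 0" "\<And>k. 1 \<le> k \<Longrightarrow> k \<le> 2 * m \<Longrightarrow> k dvd L" "L \<le> (2 * m) ^ card ?P"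
    using ex_common_multiple_le_power_primes by blast
  have "m * (2 * m choose m) dvd L" using \<open>m \<ge> 1\<close> L(2) by (intro mult_binomial_dvd) auto
  then have "m * (2 * m choose m) \<le> (2 * m) ^ card ?P" using L(1,3) by (meson dvd_imp_le le_trans)
  then have "real m * real (2 * m choose m) \<le> real ((2 * m) ^ card ?P)" by (metis of_nat_le_iff of_nat_mult)
  moreover have "4 ^ m / 2 \<le> real m * real (2 * m choose m)"
    using central_binomial_lower_bound[of m] \<open>m \<ge> 1\<close> by (simp add: field_simps)
  ultimately have "4 ^ m / 2 \<le> (2 * real m) ^ card ?P" by simp
  then have "ln (4 ^ m / 2) \<le> ln ((2 * real m) ^ card ?P)" by (intro ln_mono) auto
  moreover have "ln (4 ^ m / 2) = (2 * real m - 1) * ln 2"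
  proof -
    have "(4::real) ^ m = 2 ^ (2 * m)" by (simp add: power_mult)
    then show ?thesis by (simp add: ln_div ln_realpow algebra_simps)
  qed
  moreover have "ln ((2 * real m) ^ card ?P) = real (card ?P) * ln (2 * real m)"
    using \<open>m \<ge> 1\<close> by (simp only: ln_realpow)
  ultimately have "(2 * real m - 1) * ln 2 \<le> real (card ?P) * ln (2 * real m)" by linarith
  moreover have "card ?P \<le> prime_count x"
    unfolding prime_count_def using m(1) by (intro card_mono) auto
  then have "real (card ?P) * ln (2 * real m) \<le> real (prime_count x) * ln x"
    using m \<open>m \<ge> 1\<close> by (intro mult_mono) auto
  \<comment> \<open>Of the 3, rounding \<open>x / 2\<close> down costs 2 and the division of 4^m by
    2 costs 1.\<close>
  moreover have "(x - 3) * ln 2 \<le> (2 * real m - 1) * ln 2" using m by (intro mult_right_mono) auto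
  ultimately show ?thesis using assms by (simp add: field_simps)
qed

section \<open>The order of 2 modulo a prime\<close>

text \<open>Take a prime factor \<open>p\<close> of (x^l - 1) / (x - 1), the cyclotomic polynomial
  of index l^j at 2. The order of 2 divides l^j. If it were smaller, then x = 1 modulo
  \<open>p\<close>, the quotient would be \<open>l\<close> modulo \<open>p\<close>, and so
  \<open>p = l\<close>; but x = 2 modulo \<open>l\<close> by Fermat.\<close>

lemma ord_2_prime_power_exists:
  fixes l :: nat
  assumes l: "prime l" and j: "j \<ge> 1"
  obtains p :: nat where "prime p" "ord p 2 = l ^ j"
proof -
  define x :: nat where "x = 2 ^ (l ^ (j - 1))"
  have pos: "l ^ (j - 1) > 0" using l by (simp add: prime_gt_0_nat)
  then have x: "x \<ge> 2" unfolding x_def by (metis One_nat_def Suc_leI one_le_numeral power_increasing power_one_right)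
  have xl: "x ^ l = 2 ^ (l ^ j)" unfolding x_def using j by (cases j) (simp_all flip: power_mult add: mult.commute)
  have "l \<ge> 2" using l by (rule prime_ge_2_nat)
  have "(\<Sum>i<l. x ^ i) \<noteq> 1"
  proof -
    have "(\<Sum>i\<in>{0,1}. x ^ i) \<le> (\<Sum>i<l. x ^ i)" using \<open>l \<ge> 2\<close> by (intro sum_mono2) auto
    then show ?thesis using x by simp
  qed
  then obtain p where p: "prime p" "p dvd (\<Sum>i<l. x ^ i)" using prime_factor_nat by blast
  have "int x ^ l - 1 = (int x - 1) * (\<Sum>i<l. int x ^ i)" by (rule power_diff_1_eq)
  moreover have "int p dvd (\<Sum>i<l. int x ^ i)"
  proof -
    have "(\<Sum>i<l. int x ^ i) = int (\<Sum>i<l. x ^ i)" by simp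
    then show ?thesis using p(2) by (metis int_dvd_int_iff)
  qed
  ultimately have "int p dvd int x ^ l - 1" by simp
  then have "[int x ^ l = 1] (mod int p)" by (simp add: cong_iff_dvd_diff)
  then have "[2 ^ (l ^ j) = 1] (mod p)" using xl by (metis cong_int_iff of_nat_1 of_nat_power)
  then have "ord p 2 dvd l ^ j" by (simp add: ord_divides')
  then obtain i where i: "i \<le> j" "ord p 2 = l ^ i" using divides_primepow_nat[OF l] by blast
  have "i = j"
  proof (rule ccontr)
    assume "i \<noteq> j"
    then have "ord p 2 dvd l ^ (j - 1)" using i by (simp add: le_imp_power_dvd)
    then have x1: "[x = 1] (mod p)" unfolding x_def by (simp add: ord_divides')
    have "[(\<Sum>i<l. x ^ i) = (\<Sum>i<l. 1)] (mod p)"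
      by (intro cong_sum) (metis cong_pow power_one x1)
    then have "p dvd l" using p(2) by (simp add: cong_dvd_iff)
    then have "p = l" using p(1) l by (simp add: primes_dvd_imp_eq)
    have "[2 ^ (l ^ k) = 2] (mod l)" for k
    proof (induction k)
      case (Suc k)
      have "[2 ^ (l ^ Suc k) = 2 ^ l] (mod l)"
        using cong_pow[OF Suc, of l] by (simp add: power_mult[symmetric] mult.commute)
      moreover have "[2 ^ l = 2] (mod l)"
      proof (cases "l = 2")
        case False
        then have "\<not> l dvd 2" using l by (metis primes_dvd_imp_eq two_is_prime_nat)
        then have "[2 ^ (l - 1) * 2 = 1 * 2] (mod l)" by (intro cong_mult fermat_theorem l) auto
        moreover have "2 ^ (l - 1) * 2 = (2::nat) ^ l" using \<open>l \<ge> 2\<close> by (cases l) auto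
        ultimately show ?thesis by simp
      qed (simp add: cong_def)
      ultimately show ?case by (rule cong_trans)
    qed simp
    then have "[x = 2] (mod l)" unfolding x_def .
    with x1 \<open>p = l\<close> have "[2 = 1] (mod l)" by (metis cong_sym cong_trans)
    then show False using \<open>l \<ge> 2\<close> by (cases "l = 2") (auto simp: cong_def)
  qed
  with that p(1) i show ?thesis by blast
qed

text \<open>The order divides \<open>p - 1\<close> in the coprime case and is 0 by convention
  otherwise.\<close>

lemma ord_less_prime: "prime p \<Longrightarrow> ord p a < p" for p a :: nat
proof (cases "coprime p a")
  case True
  assume p: "prime p"
  then have "ord p a dvd p - 1" using order_divides_totient[OF True] by (simp add: totient_prime)
  then show ?thesis using prime_gt_1_nat[OF p] by (auto dest: dvd_imp_le)
qed (auto intro: prime_gt_0_nat)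

lemma dvd_power_minus_1_iff_ord: "p dvd a ^ n - 1 \<longleftrightarrow> ord p a dvd n" if "a > 0" for a p n :: nat
proof -
  have "p dvd a ^ n - 1 \<longleftrightarrow> [a ^ n = 1] (mod p)"
    using that cong_altdef_nat[of 1 "a ^ n" p] by (simp add: Suc_le_eq)
  then show ?thesis by (simp add: ord_divides')
qed

text \<open>The order divides the prime \<open>l\<close> and is not 1, as \<open>p\<close> does not
  divide 1. Hence prime factors belonging to different prime exponents are distinct.\<close>

lemma ord_2_eq_prime_exponent:
  fixes p :: nat
  assumes "prime l" "prime p" "p dvd 2 ^ l - 1"
  shows "ord p 2 = l"
proof -
  have "ord p 2 dvd l" using assms(3) dvd_power_minus_1_iff_ord[of 2 p l] by simp
  moreover have "ord p 2 \<noteq> 1"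
  proof
    assume "ord p 2 = 1"
    then have "p dvd 2 ^ 1 - 1" using dvd_power_minus_1_iff_ord[of 2 p 1] by simp
    then show False using assms(2) by simp
  qed
  ultimately show ?thesis using assms(1) by (meson prime_nat_iff)
qed

text \<open>With only one prime factor, 2^l - 1 = p^a. The exponent \<open>a\<close> is odd, since
  an odd square is 1 modulo 4 while 2^l - 1 is 3. So \<open>p + 1\<close> divides p^a + 1 = 2^l and
  is some 2^k. The order \<open>l\<close> of 2 modulo \<open>p\<close> then divides
  \<open>k\<close>, which forces 2^l - 1 \<le> p.\<close>

lemma mersenne_single_prime:
  assumes l: "prime l" and uniq: "\<And>p q. prime p \<Longrightarrow> prime q \<Longrightarrow> p dvd 2 ^ l - 1 \<Longrightarrow> q dvd 2 ^ l - 1 \<Longrightarrow> p = (q :: nat)"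
  shows "prime (2 ^ l - 1 :: nat)"
proof -
  define N :: nat where "N = 2 ^ l - 1"
  have "l \<ge> 2" using l by (rule prime_ge_2_nat)
  then have "(2::nat) ^ 2 \<le> 2 ^ l" by (intro power_increasing) auto
  then have N: "N \<ge> 3" by (simp add: N_def)
  then have "N \<noteq> 1" by simp
  then obtain p where p: "prime p" "p dvd N" using prime_factor_nat by blast
  have ordp: "ord p 2 = l" using ord_2_eq_prime_exponent[OF l p(1)] p(2) by (simp add: N_def)
  define a where "a = multiplicity p N"
  have "prime_factors N = {p}"
    using p uniq N by (auto simp: in_prime_factors_iff N_def)
  then have Npa: "N = p ^ a" using prime_factorization_nat[of N] N by (simp add: a_def)
  have "odd N" unfolding N_def using \<open>l \<ge> 2\<close> by simp
  have "odd a"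
  proof
    assume "even a"
    then obtain b where "a = 2 * b" by blast
    then have "N = (p ^ b)\<^sup>2" by (simp add: Npa power_mult mult.commute)
    moreover have "odd (p ^ b)" using \<open>odd N\<close> calculation by auto
    then obtain c where "p ^ b = 2 * c + 1" by (rule oddE)
    ultimately have "N = 4 * (c * c + c) + 1" by (simp add: power2_eq_square algebra_simps)
    moreover have "4 dvd N + 1"
    proof -
      have "(2::nat) ^ 2 dvd 2 ^ l" using \<open>l \<ge> 2\<close> by (rule le_imp_power_dvd)
      then show ?thesis by (simp add: N_def)
    qed
    ultimately show False by presburger
  qed
  have "p + 1 dvd p ^ a + 1"
  proof -
    have "[int p = -1] (mod int (p + 1))" by (simp add: cong_iff_dvd_diff add.commute)
    then have "[int p ^ a = (-1) ^ a] (mod int (p + 1))" by (rule cong_pow)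
    then have "int (p + 1) dvd int (p ^ a + 1)" using \<open>odd a\<close> by (simp add: cong_iff_dvd_diff add.commute)
    then show ?thesis by (simp only: int_dvd_int_iff)
  qed
  then have "p + 1 dvd 2 ^ l" unfolding Npa[symmetric] by (simp add: N_def)
  then obtain k where k: "p + 1 = 2 ^ k" using divides_primepow_nat[OF two_is_prime_nat] by blast
  then have "p dvd 2 ^ k - 1" by (metis add_diff_cancel_right' dvd_refl)
  then have "l dvd k" using dvd_power_minus_1_iff_ord[of 2 p k] ordp by simp
  moreover have "k > 0" using k p(1) by (cases "k = 0") auto
  ultimately have "l \<le> k" by (simp add: dvd_imp_le)
  then have "(2::nat) ^ l \<le> 2 ^ k" by (intro power_increasing) auto
  then have "N \<le> p" using k unfolding N_def by linarith
  moreover have "p \<le> N" using p(2) N by (intro dvd_imp_le) auto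
  ultimately show ?thesis using p(1) by (simp add: N_def)
qed

section \<open>The set of primes\<close>

lemma supported_part_decomposition:
  "N > 0 \<Longrightarrow> \<exists>a b. N = a * b \<and> supported_by S a \<and> (\<forall>p. prime p \<longrightarrow> p \<in> S \<longrightarrow> \<not> p dvd b)"
proof (induction N rule: less_induct)
  case (less N)
  show ?case
  proof (cases "\<exists>p. prime p \<and> p \<in> S \<and> p dvd N")
    case True
    then obtain p k where p: "prime p" "p \<in> S" "N = p * k" by blast
    have "k > 0" "k < N" using less.prems p(3) prime_gt_1_nat[OF p(1)] by auto
    then obtain a b where ab: "k = a * b" "supported_by S a" "\<forall>p. prime p \<longrightarrow> p \<in> S \<longrightarrow> \<not> p dvd b"
      using less.IH by blast
    have "supported_by S p"
      using p(1,2) unfolding supported_by_def by (auto dest: primes_dvd_imp_eq prime_gt_0_nat)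
    then have "supported_by S (p * a)" using ab(2) by (rule supported_by_mult)
    moreover have "N = p * a * b" using p(3) ab(1) by simp
    ultimately show ?thesis using ab(3) by blast
  next
    case False
    then show ?thesis by (intro exI[of _ 1] exI[of _ N]) auto
  qed
qed

lemma prod_primes_dvd:
  fixes w :: "'a \<Rightarrow> nat"
  assumes "finite Q" "inj_on w Q" "\<And>q. q \<in> Q \<Longrightarrow> prime (w q)" "\<And>q. q \<in> Q \<Longrightarrow> w q dvd a"
  shows "prod w Q dvd a"
  using assms
proof (induction Q rule: finite_induct)
  case (insert q Q)
  have "coprime (w q) (prod w Q)"
    using insert.prems insert.hyps by (intro prod_coprime_right primes_coprime) (auto simp: inj_on_def)
  moreover have "w q dvd a" "prod w Q dvd a" using insert by auto
  ultimately show ?case using insert.hyps by (simp add: divides_mult)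
qed simp

text \<open>The logarithm of \<open>n\<close> is the sum of the von Mangoldt function over the prime
  powers \<open>q\<close> dividing \<open>n\<close>. Each such \<open>q\<close> has a prime
  \<open>w q > q\<close> in \<open>S\<close> that divides 2^n - 1, hence \<open>a\<close>. These
  primes are distinct because the order of 2 recovers \<open>q\<close>, so their product divides
  \<open>a\<close>.\<close>

lemma supported_part_ge:
  fixes a b n :: nat
  assumes S: "\<And>q. primepow q \<Longrightarrow> \<exists>p\<in>S. prime p \<and> ord p 2 = q"
    and n: "n \<ge> 1" and ab: "2 ^ n - 1 = a * b" and b: "\<And>p. prime p \<Longrightarrow> p \<in> S \<Longrightarrow> \<not> p dvd b"
  shows "n \<le> a"
proof -
  obtain w where w: "\<And>q. primepow q \<Longrightarrow> w q \<in> S" "\<And>q. primepow q \<Longrightarrow> prime (w q)"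
    "\<And>q. primepow q \<Longrightarrow> ord (w q) 2 = q" using S by metis
  define Q where "Q = {q. primepow q \<and> q dvd n}"
  have fin: "finite Q" unfolding Q_def using n by simp
  have "(2::nat) ^ n > 1" using n by (intro one_less_power) auto
  then have "a > 0" using ab by (cases "a = 0") auto
  have "prod w Q dvd a"
  proof (rule prod_primes_dvd[OF fin])
    show "inj_on w Q" by (rule inj_onI) (metis Q_def mem_Collect_eq w(3))
    fix q assume q: "q \<in> Q"
    then show pr: "prime (w q)" using w(2) by (simp add: Q_def)
    have "w q dvd 2 ^ n - 1"
      using dvd_power_minus_1_iff_ord[of 2 "w q" n] w(3)[of q] q by (simp add: Q_def)
    then have "w q dvd a * b" unfolding ab .
    moreover have "\<not> w q dvd b" using b[OF pr] w(1) q by (simp add: Q_def)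
    ultimately show "w q dvd a" using pr by (simp add: prime_dvd_mult_iff)
  qed
  then have "prod w Q \<le> a" using \<open>a > 0\<close> by (rule dvd_imp_le)
  have "ln (real n) = (\<Sum>d | d dvd n. mangoldt d)" using mangoldt_sum[of n, where 'a = real] n by simp
  also have "\<dots> = (\<Sum>q\<in>Q. mangoldt q)"
    using n by (intro sum.mono_neutral_right) (auto simp: Q_def mangoldt_def)
  also have "\<dots> \<le> (\<Sum>q\<in>Q. ln (real (w q)))"
  proof (rule sum_mono)
    fix q assume "q \<in> Q"
    then have q: "primepow q" by (simp add: Q_def)
    then have "q > 0" by (rule primepow_gt_0_nat)
    then have "mangoldt q \<le> ln (real q)" by (rule mangoldt_le)
    also have "q \<le> w q" using ord_less_prime[OF w(2)[OF q], of 2] w(3)[OF q] by simp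
    then have "ln (real q) \<le> ln (real (w q))" using \<open>q > 0\<close> by (intro ln_mono) auto
    finally show "mangoldt q \<le> ln (real (w q))" .
  qed
  also have "\<dots> = ln (real (prod w Q))"
    unfolding of_nat_prod using fin by (subst ln_prod) (auto simp: Q_def intro!: prime_gt_0_nat w(2))
  also have "\<dots> \<le> ln (real a)"
  proof (intro ln_mono)
    have "prod w Q > 0" by (intro prod_pos) (auto simp: Q_def intro!: prime_gt_0_nat w(2))
    then show "real (prod w Q) > 0" by (simp only: of_nat_0_less_iff)
    show "real (prod w Q) \<le> real a" using \<open>prod w Q \<le> a\<close> by (simp only: of_nat_le_iff)
  qed
  finally show "n \<le> a" using n \<open>a > 0\<close> by simp
qed

section \<open>Construction of a set of primes of density 1/2\<close>

text \<open>The label \<kappa> tells to which \<open>l\<close> a member of a pair belongs, so the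
  pairs are disjoint and exchanging their members is an involution \<open>f\<close>. The involution
  \<open>g\<close> exchanges the primes of index \<open>2 * j\<close> and
  \<open>2 * j + 1\<close>.\<close>

lemma ex_colouring_splitting_prime_pairs:
  fixes u v :: "nat \<Rightarrow> nat"
  assumes u: "\<And>l. l \<in> A \<Longrightarrow> prime (u l) \<and> \<kappa> (u l) = l" and v: "\<And>l. l \<in> A \<Longrightarrow> prime (v l) \<and> \<kappa> (v l) = l"
    and uv: "\<And>l. l \<in> A \<Longrightarrow> u l \<noteq> v l"
  shows "\<exists>c :: nat \<Rightarrow> bool. (\<forall>j. c (nth_prime (Suc (2 * j))) \<longleftrightarrow> \<not> c (nth_prime (2 * j))) \<and>
    (\<forall>l\<in>A. c (u l) \<noteq> c (v l))"
proof -
  define f where "f p = (if \<kappa> p \<in> A \<and> p = u (\<kappa> p) then v (\<kappa> p)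
      else if \<kappa> p \<in> A \<and> p = v (\<kappa> p) then u (\<kappa> p) else p)" for p
  have f: "f (f p) = p" for p using u v uv by (auto simp: f_def)
  define swap where "swap i = (if even i then Suc i else i - 1)" for i :: nat
  have swap: "swap (swap i) = i" for i by (auto simp: swap_def)
  define idx where "idx = inv_into UNIV nth_prime"
  define g where "g p = (if prime p then nth_prime (swap (idx p)) else p)" for p
  have bij: "inj nth_prime" "range nth_prime = {p. prime p}"
    using bij_enumerate[OF primes_infinite] by (auto simp: bij_betw_def)
  have idx: "idx (nth_prime i) = i" for i unfolding idx_def using bij(1) by simp
  have prime: "prime (nth_prime i)" for i using bij(2) by blast
  have g_nth: "g (nth_prime i) = nth_prime (swap i)" for i by (simp add: g_def prime idx)
  have g: "g (g p) = p" for p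
  proof (cases "prime p")
    case True
    then obtain i where "p = nth_prime i" using bij(2) by blast
    then show ?thesis by (simp add: g_nth swap)
  qed (simp add: g_def)
  obtain c :: "nat \<Rightarrow> bool" where c: "\<forall>p. f p \<noteq> p \<longrightarrow> c (f p) \<noteq> c p" "\<forall>p. g p \<noteq> p \<longrightarrow> c (g p) \<noteq> c p"
    using involutions_2_colouring[of f g, OF f g] by blast
  show ?thesis
  proof (intro exI[of _ c] conjI allI ballI)
    fix j
    have "g (nth_prime (2 * j)) = nth_prime (Suc (2 * j))" by (simp add: g_nth swap_def)
    moreover have "nth_prime (Suc (2 * j)) \<noteq> nth_prime (2 * j)" using bij(1) by (metis injD n_not_Suc_n)
    ultimately show "c (nth_prime (Suc (2 * j))) \<longleftrightarrow> \<not> c (nth_prime (2 * j))" using c(2)[rule_format, of "nth_prime (2 * j)"] by auto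
  next
    fix l assume l: "l \<in> A"
    then have "f (u l) = v l" using u by (simp add: f_def)
    then show "c (u l) \<noteq> c (v l)" using c(1)[rule_format, of "u l"] uv[OF l] by auto
  qed
qed

text \<open>If l^j \<le> x with \<open>j \<ge> 2\<close>, then \<open>l\<close> is at most the
  square root of \<open>x\<close> and \<open>j\<close> at most its binary logarithm. Counting index
  0 as well adds 1 to each factor.\<close>

lemma card_prime_power_image_le:
  fixes w :: "nat \<Rightarrow> nat"
  assumes w: "\<And>l j. prime l \<Longrightarrow> j \<ge> 1 \<Longrightarrow> l ^ j \<le> w (l ^ j)" and x: "x \<ge> 1"
  shows "real (card {p \<in> {w (l ^ j) | l j. prime l \<and> j \<ge> 2}. real p \<le> x}) \<le> (sqrt x + 1) * (log 2 x + 1)"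
proof -
  let ?A = "{p \<in> {w (l ^ j) | l j. prime l \<and> j \<ge> 2}. real p \<le> x}"
  let ?B = "{..nat \<lfloor>sqrt x\<rfloor>} \<times> {..nat \<lfloor>log 2 x\<rfloor>}"
  have "?A \<subseteq> (\<lambda>(l, j). w (l ^ j)) ` ?B"
  proof
    fix p assume "p \<in> ?A"
    then obtain l j where lj: "p = w (l ^ j)" "prime l" "j \<ge> 2" "real p \<le> x" by blast
    have l: "l \<ge> 2" using lj(2) by (rule prime_ge_2_nat)
    have "real (l ^ j) \<le> real p" using w[OF lj(2), of j] lj(1,3) by simp
    then have "real (l ^ j) \<le> x" using lj(4) by (rule order_trans)
    then have ljx: "real l ^ j \<le> x" by simp
    have "real l ^ 2 \<le> real l ^ j" using l lj(3) by (intro power_increasing) auto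
    then have "real l \<le> sqrt x" using ljx by (intro real_le_rsqrt) simp
    moreover have "2 ^ j \<le> real l ^ j" using l by (intro power_mono) auto
    then have "real j \<le> log 2 x" using ljx by (intro le_log_of_power) auto
    ultimately have "(l, j) \<in> ?B" by (simp add: le_nat_floor)
    then show "p \<in> (\<lambda>(l, j). w (l ^ j)) ` ?B" using lj(1) by force
  qed
  then have "card ?A \<le> card ?B" by (rule surj_card_le[rotated]) simp
  then have "real (card ?A) \<le> (real (nat \<lfloor>sqrt x\<rfloor>) + 1) * (real (nat \<lfloor>log 2 x\<rfloor>) + 1)"
    by (simp flip: of_nat_mult of_nat_Suc add: add.commute)
  also have "\<dots> \<le> (sqrt x + 1) * (log 2 x + 1)"
    using x by (intro mult_mono add_mono of_nat_floor) auto
  finally show ?thesis .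
qed

lemma card_mersenne_le:
  assumes x: "x \<ge> 1"
  shows "real (card {p \<in> {p. \<exists>l. prime p \<and> p = 2 ^ l - 1}. real p \<le> x}) \<le> log 2 (x + 1) + 1"
proof -
  let ?A = "{p \<in> {p. \<exists>l. prime p \<and> p = 2 ^ l - 1}. real p \<le> x}"
  let ?B = "{..nat \<lfloor>log 2 (x + 1)\<rfloor>}"
  have "?A \<subseteq> (\<lambda>l. 2 ^ l - 1) ` ?B"
  proof
    fix p assume "p \<in> ?A"
    then obtain l where l: "p = 2 ^ l - 1" "real p \<le> x" by blast
    then have "(2::real) ^ l \<le> x + 1" by (simp add: of_nat_diff)
    then have "real l \<le> log 2 (x + 1)" by (intro le_log_of_power) auto
    then have "l \<in> ?B" by (simp add: le_nat_floor)
    then show "p \<in> (\<lambda>l. 2 ^ l - 1) ` ?B" using l(1) by blast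
  qed
  then have "card ?A \<le> card ?B" by (rule surj_card_le[rotated]) simp
  then have "real (card ?A) \<le> real (nat \<lfloor>log 2 (x + 1)\<rfloor>) + 1" by simp
  also have "real (nat \<lfloor>log 2 (x + 1)\<rfloor>) \<le> log 2 (x + 1)" using x by (intro of_nat_floor) auto
  finally show ?thesis by simp
qed

lemma ex_primes_density_half:
  obtains S :: "nat set" where "S \<subseteq> {p. prime p}" "has_prime_density S (1/2)"
    "\<And>q. primepow q \<Longrightarrow> \<exists>p\<in>S. prime p \<and> ord p 2 = q"
proof -
  \<comment> \<open>The prime exponents for which a pair of distinct prime factors can be
    chosen.\<close>
  define A where "A = {l. prime l \<and> (\<exists>p q::nat. prime p \<and> prime q \<and> p \<noteq> q \<and> p dvd 2 ^ l - 1 \<and> q dvd 2 ^ l - 1)}"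
  then have "\<forall>l\<in>A. \<exists>p q::nat. prime p \<and> prime q \<and> p \<noteq> q \<and> p dvd 2 ^ l - 1 \<and> q dvd 2 ^ l - 1" by blast
  then obtain u v :: "nat \<Rightarrow> nat" where uv: "\<And>l. l \<in> A \<Longrightarrow> prime (u l)" "\<And>l. l \<in> A \<Longrightarrow> prime (v l)"
    "\<And>l. l \<in> A \<Longrightarrow> u l \<noteq> v l" "\<And>l. l \<in> A \<Longrightarrow> u l dvd 2 ^ l - 1" "\<And>l. l \<in> A \<Longrightarrow> v l dvd 2 ^ l - 1"
    by metis
  have ordA: "ord (u l) 2 = l" "ord (v l) 2 = l" if "l \<in> A" for l
    using ord_2_eq_prime_exponent uv that by (auto simp: A_def)
  have "prime (u l) \<and> ord (u l) 2 = l" "prime (v l) \<and> ord (v l) 2 = l" if "l \<in> A" for l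
    using uv(1,2) ordA that by simp_all
  note splitting = ex_colouring_splitting_prime_pairs[of A u "\<lambda>p. ord p 2" v, OF this uv(3)]
  obtain c where c: "\<forall>j. c (nth_prime (Suc (2 * j))) \<longleftrightarrow> \<not> c (nth_prime (2 * j))"
    "\<forall>l\<in>A. c (u l) \<noteq> c (v l)"
    using splitting by blast
  have "\<exists>p::nat. prime p \<and> ord p 2 = q" if q: "primepow q" for q
  proof -
    obtain l k where lk: "prime l" "k > 0" "q = l ^ k" using q unfolding primepow_def by blast
    from lk(2) have "k \<ge> 1" by simp
    from ord_2_prime_power_exists[OF lk(1) this] lk(3) show ?thesis by blast
  qed
  then obtain w :: "nat \<Rightarrow> nat" where w: "\<And>q. primepow q \<Longrightarrow> prime (w q)" "\<And>q. primepow q \<Longrightarrow> ord (w q) 2 = q" by metis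
  \<comment> \<open>\<open>E1\<close> takes care of the proper prime powers, and \<open>E2\<close>,
    the Mersenne primes, of the prime exponents outside \<open>A\<close>.\<close>
  define E1 where "E1 = {w (l ^ j) | l j. prime l \<and> j \<ge> 2}"
  define E2 where "E2 = {p::nat. \<exists>l. prime p \<and> p = 2 ^ l - 1}"
  have w_ge: "l ^ j \<le> w (l ^ j)" if "prime l" "j \<ge> 1" for l j
  proof -
    have "primepow (l ^ j)" using that by simp
    then show ?thesis using ord_less_prime[OF w(1), of "l ^ j" 2] w(2) by simp
  qed
  have E: "E1 \<union> E2 \<subseteq> {p. prime p}" using w(1) by (auto simp: E1_def E2_def)
  have inf: "filterlim (\<lambda>x. real (prime_count x)) at_top at_top"
  proof (rule filterlim_at_top_mono)
    show "filterlim (\<lambda>x::real. (x - 3) * ln 2 / ln x) at_top at_top" by real_asymp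
    show "\<forall>\<^sub>F x in at_top. (x - 3) * ln 2 / ln x \<le> real (prime_count x)"
      using eventually_ge_at_top[of 4] by eventually_elim (rule prime_count_ge)
  qed
  \<comment> \<open>An upper bound for the size of the exceptional set, of order sqrt x log x, to be
    compared with x / log x from Chebyshev's bound.\<close>
  define K where "K x = (sqrt x + 1) * (log 2 x + 1) + (log 2 (x + 1) + 1)" for x
  have "((\<lambda>x. real (card {p \<in> E1 \<union> E2. real p \<le> x}) / real (prime_count x)) \<longlongrightarrow> 0) at_top"
  proof (rule tendsto_sandwich[where f = "\<lambda>_. 0"])
    show "((\<lambda>x. K x / ((x - 3) * ln 2 / ln x)) \<longlongrightarrow> 0) at_top" unfolding K_def by real_asymp
    show "\<forall>\<^sub>F x in at_top. real (card {p \<in> E1 \<union> E2. real p \<le> x}) / real (prime_count x) \<le> K x / ((x - 3) * ln 2 / ln x)"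
      using eventually_ge_at_top[of 4]
    proof eventually_elim
      case (elim x)
      have "{p \<in> E1 \<union> E2. real p \<le> x} = {p \<in> E1. real p \<le> x} \<union> {p \<in> E2. real p \<le> x}" by blast
      then have "card {p \<in> E1 \<union> E2. real p \<le> x} \<le> card {p \<in> E1. real p \<le> x} + card {p \<in> E2. real p \<le> x}"
        by (simp only: card_Un_le)
      then have "real (card {p \<in> E1 \<union> E2. real p \<le> x}) \<le>
          real (card {p \<in> E1. real p \<le> x}) + real (card {p \<in> E2. real p \<le> x})"
        by (simp only: of_nat_le_iff flip: of_nat_add)
      also have "\<dots> \<le> K x"
        using card_prime_power_image_le[of w x, OF w_ge] card_mersenne_le[of x] elim
        unfolding K_def E1_def E2_def by (intro add_mono) auto
      finally have *: "real (card {p \<in> E1 \<union> E2. real p \<le> x}) \<le> K x" .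
      show ?case
      proof (rule frac_le)
        show "0 \<le> K x" using * by (rule order_trans[rotated]) simp
        show "0 < (x - 3) * ln 2 / ln x" using elim by simp
      qed (use * prime_count_ge[OF elim] in auto)
    qed
  qed (auto intro!: always_eventually)
  from has_prime_density_half[OF c(1)[rule_format] E this inf]
  have dens: "has_prime_density ({p. prime p \<and> c p} \<union> (E1 \<union> E2)) (1/2)" .
  have "\<exists>p\<in>{p. prime p \<and> c p} \<union> (E1 \<union> E2). prime p \<and> ord p 2 = q" if q: "primepow q" for q
  proof -
    obtain l j where lj: "prime l" "j > 0" "q = l ^ j" using q unfolding primepow_def by blast
    consider "j \<ge> 2" | "j = 1" "l \<in> A" | "j = 1" "l \<notin> A" using lj(2) by linarith
    then show ?thesis
    proof cases
      case 1
      then have "w q \<in> E1" using lj by (auto simp: E1_def)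
      then show ?thesis using w q by blast
    next
      case 2
      \<comment> \<open>The two primes have different colours, so one of them lies in the chosen
        class; for both the order of 2 is \<open>l\<close>.\<close>
      then show ?thesis using c(2)[rule_format, of l] uv(1,2)[of l] ordA[of l] lj(3) by auto
    next
      case 3
      have pr: "prime (2 ^ l - 1 :: nat)"
        using 3(2) lj(1) by (intro mersenne_single_prime) (auto simp: A_def)
      then have "ord (2 ^ l - 1) (2::nat) = l" using lj(1) by (intro ord_2_eq_prime_exponent) auto
      moreover have "2 ^ l - 1 \<in> E2" using pr by (auto simp: E2_def)
      ultimately show ?thesis using pr 3(1) lj(3) by auto
    qed
  qed
  moreover have "{p. prime p \<and> c p} \<union> (E1 \<union> E2) \<subseteq> {p. prime p}" using E by auto
  ultimately show ?thesis using that dens by blast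
qed

theorem proposition3:
  shows "\<exists>S \<subseteq> {p::nat. prime p}.
           (\<exists>d. 0 < d \<and> d < 1 \<and> has_prime_density S d) \<and>
           (\<exists>C::real. (\<lambda>N. M_sum S N - C) \<in> O(\<lambda>N. 1 / real N))"
proof -
  obtain S :: "nat set" where S: "S \<subseteq> {p. prime p}" "has_prime_density S (1/2)"
    "\<And>q. primepow q \<Longrightarrow> \<exists>p\<in>S. prime p \<and> ord p 2 = q"
    using ex_primes_density_half by blast
  have "\<exists>C. (\<lambda>N. M_sum S N - C) \<in> O(\<lambda>N. 1 / real N)"
  proof (rule M_sum_asymptotics)
    fix n :: nat assume n: "n \<ge> 1"
    then have "(2::nat) ^ n > 1" by (intro one_less_power) auto
    then obtain a b where ab: "2 ^ n - 1 = a * b" "supported_by S a" "\<forall>p. prime p \<longrightarrow> p \<in> S \<longrightarrow> \<not> p dvd b"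
      using supported_part_decomposition[of "2 ^ n - 1" S] by auto
    moreover have "n \<le> a" using supported_part_ge[OF S(3) n ab(1)] ab(3) by blast
    ultimately show "\<exists>a b. 2 ^ n - 1 = a * b \<and> supported_by S a \<and> n \<le> a \<and>
      (\<forall>p. prime p \<longrightarrow> p \<in> S \<longrightarrow> \<not> p dvd b)" by blast
  qed
  moreover have "\<exists>d::real. 0 < d \<and> d < 1 \<and> has_prime_density S d" using S(2) by (intro exI[of _ "1/2"]) simp
  ultimately show ?thesis using S(1) by blast
qed

end
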